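(* Let $(I,\alpha)$ be a unit object in a semi-monoidal 2-category $\mathcal{C}$. For each object $X$ there exist pairs $(\lambda_X,L_X)$ and $(\rho_X,R_X)$, $$\lambda_X:IX\to X,\quad L_X:I\lambda_X\Rightarrow\alpha X,\qquad \rho_X:XI\to X,\quad R_X:X\alpha\Rightarrow\rho_XI,$$ where $\lambda_X$ and $\rho_X$ are equi-arrows and $L_X$ and $R_X$ are invertible 2-cells. Moreover, for every such family there is a unique way to assemble the $\lambda_X$ into a natural transformation (i.e. to define 2-cells $\lambda_f:If\#\lambda_Y\Rightarrow\lambda_X\#f$ for every arrow $f:X\to Y$ of $\mathcal{C}$) in such a way that $L$ is a modification; similarly there is a unique way to assemble the $\rho_X$ into a natural transformation (with 2-cells $\rho_f:fI\#\rho_Y\Rightarrow\rho_X\#f$) such that $R$ is a modification.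
   Context: A semi-monoidal 2-category $\mathcal{C}$ is a strict 2-category with a strict 2-functor $\mathcal{C}\times\mathcal{C}\to\mathcal{C}$, $(X,Y)\mapsto XY$ (tensor product, written by juxtaposition), strictly associative. No unit is assumed. $\#$ denotes composition of arrows and horizontal composition of 2-cells (including whiskering), written left to right; $\bullet$ denotes vertical composition of 2-cells, also left to right. The name of an object (arrow) also denotes its identity arrow (identity 2-cell). An equi-arrow is an arrow admitting a pseudo-inverse. Natural transformation means pseudo-natural transformation (with invertible 2-cell components on arrows, compatible with composition, identities and 2-cells); here $\lambda$ goes from the 2-functor $X\mapsto IX$ to the identity, $\rho$ from $X\mapsto XI$ to the identity. An object $I$ is cancellable if $X\mapsto IX$ and $X\mapsto XI$ are fully faithful 2-functors, i.e. induce equivalences on hom categories. A unit object is a pair $(I,\alpha)$ with $I$ cancellable and $\alpha: II\to I$ an equi-arrow. $L$ is a modification (from $I\lambda$ to the natural transformation with components $\alpha X$ and identity 2-cells on arrows) if for each $f:X\to Y$, $(I\lambda_f)\bullet(L_X\#If)=IIf\#L_Y$. $R$ is a modification if for each $f:X\to Y$, $R_X\#fI=(fII\#R_Y)\bullet(\rho_fI)$. *)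

theory Defs
  imports Main "HOL-Library.FuncSet"
begin

section \<open>Categories, functors and equivalences of categories\<close>

text \<open>Composition is written in diagrammatic (left-to-right) order throughout.\<close>

record ('o, 'a) cat =
  cobj :: "'o set"
  carr :: "'a set"
  cdom :: "'a \<Rightarrow> 'o"
  ccod :: "'a \<Rightarrow> 'o"
  cid :: "'o \<Rightarrow> 'a"
  ccomp :: "'a \<Rightarrow> 'a \<Rightarrow> 'a"

record ('o, 'a, 'p, 'b) cat_functor =
  fobj :: "'o \<Rightarrow> 'p"
  farr :: "'a \<Rightarrow> 'b"

definition is_functor ::
  "('o, 'a) cat \<Rightarrow> ('p, 'b) cat \<Rightarrow> ('o, 'a, 'p, 'b) cat_functor \<Rightarrow> bool" where
  "is_functor A B F \<longleftrightarrow>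
     (\<forall>x\<in>cobj A. fobj F x \<in> cobj B) \<and>
     (\<forall>u\<in>carr A. farr F u \<in> carr B \<and>
        cdom B (farr F u) = fobj F (cdom A u) \<and> ccod B (farr F u) = fobj F (ccod A u)) \<and>
     (\<forall>x\<in>cobj A. farr F (cid A x) = cid B (fobj F x)) \<and>
     (\<forall>u\<in>carr A. \<forall>v\<in>carr A. ccod A u = cdom A v \<longrightarrow>
        farr F (ccomp A u v) = ccomp B (farr F u) (farr F v))"

definition id_functor :: "('o, 'a, 'o, 'a) cat_functor" where
  "id_functor = \<lparr>fobj = (\<lambda>x. x), farr = (\<lambda>u. u)\<rparr>"

definition comp_functor ::
  "('o, 'a, 'p, 'b) cat_functor \<Rightarrow> ('p, 'b, 'q, 'd) cat_functor \<Rightarrow> ('o, 'a, 'q, 'd) cat_functor" where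
  "comp_functor F G = \<lparr>fobj = (\<lambda>x. fobj G (fobj F x)), farr = (\<lambda>u. farr G (farr F u))\<rparr>"

definition cat_iso :: "('o, 'a) cat \<Rightarrow> 'a \<Rightarrow> bool" where
  "cat_iso A u \<longleftrightarrow> u \<in> carr A \<and>
     (\<exists>v\<in>carr A. cdom A v = ccod A u \<and> ccod A v = cdom A u \<and>
        ccomp A u v = cid A (cdom A u) \<and> ccomp A v u = cid A (ccod A u))"

definition naturally_isomorphic ::
  "('o, 'a) cat \<Rightarrow> ('p, 'b) cat \<Rightarrow> ('o, 'a, 'p, 'b) cat_functor \<Rightarrow> ('o, 'a, 'p, 'b) cat_functor \<Rightarrow> bool" where
  "naturally_isomorphic A B F G \<longleftrightarrow>
     (\<exists>\<eta>. (\<forall>x\<in>cobj A. cat_iso B (\<eta> x) \<and> cdom B (\<eta> x) = fobj F x \<and> ccod B (\<eta> x) = fobj G x) \<and>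
          (\<forall>u\<in>carr A. ccomp B (farr F u) (\<eta> (ccod A u)) = ccomp B (\<eta> (cdom A u)) (farr G u)))"

definition cat_equivalence ::
  "('o, 'a) cat \<Rightarrow> ('p, 'b) cat \<Rightarrow> ('o, 'a, 'p, 'b) cat_functor \<Rightarrow> bool" where
  "cat_equivalence A B F \<longleftrightarrow> is_functor A B F \<and>
     (\<exists>G. is_functor B A G \<and>
          naturally_isomorphic A A id_functor (comp_functor F G) \<and>
          naturally_isomorphic B B (comp_functor G F) id_functor)"


section \<open>Strict 2-categories\<close>

text \<open>Arrow composition (\<open>\<star>\<^sub>1\<close>) and horizontal composition (\<open>\<star>\<^sub>2\<close>) of 2-cells are both written
  \<open>#\<close> in the literature, since an arrow is identified there with its identity 2-cell. Here
  whiskering by an arrow \<open>f\<close> is horizontal composition with \<open>id2 C f\<close>.\<close>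

record ('o, 'a, 'c) two_cat =
  Obj :: "'o set"
  Arr :: "'a set"
  Cell :: "'c set"
  src :: "'a \<Rightarrow> 'o"
  tgt :: "'a \<Rightarrow> 'o"
  dom2 :: "'c \<Rightarrow> 'a"
  cod2 :: "'c \<Rightarrow> 'a"
  id1 :: "'o \<Rightarrow> 'a"
  id2 :: "'a \<Rightarrow> 'c"
  comp1 :: "'a \<Rightarrow> 'a \<Rightarrow> 'a"  (infixl "\<star>\<^sub>1\<index>" 70)
  hcomp :: "'c \<Rightarrow> 'c \<Rightarrow> 'c"  (infixl "\<star>\<^sub>2\<index>" 70)
  vcomp :: "'c \<Rightarrow> 'c \<Rightarrow> 'c"  (infixl "\<bullet>\<index>" 65)

definition hom :: "('o, 'a, 'c, 'm) two_cat_scheme \<Rightarrow> 'o \<Rightarrow> 'o \<Rightarrow> 'a set" where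
  "hom C X Y = {f \<in> Arr C. src C f = X \<and> tgt C f = Y}"

definition cells :: "('o, 'a, 'c, 'm) two_cat_scheme \<Rightarrow> 'a \<Rightarrow> 'a \<Rightarrow> 'c set" where
  "cells C f g = {\<phi> \<in> Cell C. dom2 C \<phi> = f \<and> cod2 C \<phi> = g}"

locale strict_2category =
  fixes C :: "('o, 'a, 'c, 'm) two_cat_scheme" (structure)
  assumes src_tgt: "f \<in> Arr C \<Longrightarrow> src C f \<in> Obj C \<and> tgt C f \<in> Obj C"
    and dom2_cod2: "\<phi> \<in> Cell C \<Longrightarrow> dom2 C \<phi> \<in> Arr C \<and> cod2 C \<phi> \<in> Arr C"
    and parallel: "\<phi> \<in> Cell C \<Longrightarrow>
      src C (dom2 C \<phi>) = src C (cod2 C \<phi>) \<and> tgt C (dom2 C \<phi>) = tgt C (cod2 C \<phi>)"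
    and id1_hom: "X \<in> Obj C \<Longrightarrow> id1 C X \<in> hom C X X"
    and comp1_hom: "\<lbrakk>f \<in> hom C X Y; g \<in> hom C Y Z\<rbrakk> \<Longrightarrow> f \<star>\<^sub>1 g \<in> hom C X Z"
    and id1_left: "f \<in> hom C X Y \<Longrightarrow> id1 C X \<star>\<^sub>1 f = f"
    and id1_right: "f \<in> hom C X Y \<Longrightarrow> f \<star>\<^sub>1 id1 C Y = f"
    and comp1_assoc: "\<lbrakk>f \<in> hom C W X; g \<in> hom C X Y; h \<in> hom C Y Z\<rbrakk> \<Longrightarrow>
      (f \<star>\<^sub>1 g) \<star>\<^sub>1 h = f \<star>\<^sub>1 (g \<star>\<^sub>1 h)"
    and id2_cells: "f \<in> Arr C \<Longrightarrow> id2 C f \<in> cells C f f"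
    and vcomp_cells: "\<lbrakk>\<phi> \<in> cells C f g; \<psi> \<in> cells C g h\<rbrakk> \<Longrightarrow> \<phi> \<bullet> \<psi> \<in> cells C f h"
    and id2_left: "\<phi> \<in> cells C f g \<Longrightarrow> id2 C f \<bullet> \<phi> = \<phi>"
    and id2_right: "\<phi> \<in> cells C f g \<Longrightarrow> \<phi> \<bullet> id2 C g = \<phi>"
    and vcomp_assoc: "\<lbrakk>\<phi> \<in> cells C f g; \<psi> \<in> cells C g h; \<chi> \<in> cells C h k\<rbrakk> \<Longrightarrow>
      (\<phi> \<bullet> \<psi>) \<bullet> \<chi> = \<phi> \<bullet> (\<psi> \<bullet> \<chi>)"
    and hcomp_cells: "\<lbrakk>\<phi> \<in> cells C f f'; \<psi> \<in> cells C g g'; tgt C f = src C g\<rbrakk> \<Longrightarrow>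
      \<phi> \<star>\<^sub>2 \<psi> \<in> cells C (f \<star>\<^sub>1 g) (f' \<star>\<^sub>1 g')"
    and hcomp_left: "\<lbrakk>\<phi> \<in> cells C f g; f \<in> hom C X Y\<rbrakk> \<Longrightarrow> id2 C (id1 C X) \<star>\<^sub>2 \<phi> = \<phi>"
    and hcomp_right: "\<lbrakk>\<phi> \<in> cells C f g; f \<in> hom C X Y\<rbrakk> \<Longrightarrow> \<phi> \<star>\<^sub>2 id2 C (id1 C Y) = \<phi>"
    and hcomp_assoc: "\<lbrakk>\<phi> \<in> cells C f f'; \<psi> \<in> cells C g g'; \<chi> \<in> cells C h h';
        tgt C f = src C g; tgt C g = src C h\<rbrakk> \<Longrightarrow>
      (\<phi> \<star>\<^sub>2 \<psi>) \<star>\<^sub>2 \<chi> = \<phi> \<star>\<^sub>2 (\<psi> \<star>\<^sub>2 \<chi>)"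
    and hcomp_id2: "\<lbrakk>f \<in> hom C X Y; g \<in> hom C Y Z\<rbrakk> \<Longrightarrow> id2 C f \<star>\<^sub>2 id2 C g = id2 C (f \<star>\<^sub>1 g)"
    and interchange: "\<lbrakk>\<phi> \<in> cells C f f'; \<phi>' \<in> cells C f' f''; \<psi> \<in> cells C g g'; \<psi>' \<in> cells C g' g'';
        tgt C f = src C g\<rbrakk> \<Longrightarrow>
      (\<phi> \<bullet> \<phi>') \<star>\<^sub>2 (\<psi> \<bullet> \<psi>') = (\<phi> \<star>\<^sub>2 \<psi>) \<bullet> (\<phi>' \<star>\<^sub>2 \<psi>')"

definition invertible_cell :: "('o, 'a, 'c, 'm) two_cat_scheme \<Rightarrow> 'c \<Rightarrow> bool" where
  "invertible_cell C \<phi> \<longleftrightarrow> \<phi> \<in> Cell C \<and>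
     (\<exists>\<psi>\<in>cells C (cod2 C \<phi>) (dom2 C \<phi>).
        \<phi> \<bullet>\<^bsub>C\<^esub> \<psi> = id2 C (dom2 C \<phi>) \<and> \<psi> \<bullet>\<^bsub>C\<^esub> \<phi> = id2 C (cod2 C \<phi>))"

definition equi_arrow :: "('o, 'a, 'c, 'm) two_cat_scheme \<Rightarrow> 'a \<Rightarrow> bool" where
  "equi_arrow C f \<longleftrightarrow> f \<in> Arr C \<and>
     (\<exists>g\<in>hom C (tgt C f) (src C f).
        (\<exists>\<eta>\<in>cells C (f \<star>\<^sub>1\<^bsub>C\<^esub> g) (id1 C (src C f)). invertible_cell C \<eta>) \<and>
        (\<exists>\<epsilon>\<in>cells C (g \<star>\<^sub>1\<^bsub>C\<^esub> f) (id1 C (tgt C f)). invertible_cell C \<epsilon>))"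

definition hom_cat :: "('o, 'a, 'c, 'm) two_cat_scheme \<Rightarrow> 'o \<Rightarrow> 'o \<Rightarrow> ('a, 'c) cat" where
  "hom_cat C X Y =
     \<lparr>cobj = hom C X Y,
      carr = {\<phi> \<in> Cell C. dom2 C \<phi> \<in> hom C X Y \<and> cod2 C \<phi> \<in> hom C X Y},
      cdom = dom2 C, ccod = cod2 C, cid = id2 C, ccomp = vcomp C\<rparr>"

definition prod_2cat ::
  "('o, 'a, 'c, 'm) two_cat_scheme \<Rightarrow> ('p, 'b, 'd, 'n) two_cat_scheme \<Rightarrow>
   ('o \<times> 'p, 'a \<times> 'b, 'c \<times> 'd) two_cat" where
  "prod_2cat C D =
     \<lparr>Obj = Obj C \<times> Obj D, Arr = Arr C \<times> Arr D, Cell = Cell C \<times> Cell D,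
      src = map_prod (src C) (src D), tgt = map_prod (tgt C) (tgt D),
      dom2 = map_prod (dom2 C) (dom2 D), cod2 = map_prod (cod2 C) (cod2 D),
      id1 = map_prod (id1 C) (id1 D), id2 = map_prod (id2 C) (id2 D),
      comp1 = (\<lambda>(f, f') (g, g'). (f \<star>\<^sub>1\<^bsub>C\<^esub> g, f' \<star>\<^sub>1\<^bsub>D\<^esub> g')),
      hcomp = (\<lambda>(\<phi>, \<phi>') (\<psi>, \<psi>'). (\<phi> \<star>\<^sub>2\<^bsub>C\<^esub> \<psi>, \<phi>' \<star>\<^sub>2\<^bsub>D\<^esub> \<psi>')),
      vcomp = (\<lambda>(\<phi>, \<phi>') (\<psi>, \<psi>'). (\<phi> \<bullet>\<^bsub>C\<^esub> \<psi>, \<phi>' \<bullet>\<^bsub>D\<^esub> \<psi>'))\<rparr>"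


section \<open>Strict 2-functors and pseudo-natural transformations\<close>

record ('o, 'a, 'c, 'p, 'b, 'd) two_functor =
  on_obj :: "'o \<Rightarrow> 'p"
  on_arr :: "'a \<Rightarrow> 'b"
  on_cell :: "'c \<Rightarrow> 'd"

locale strict_2functor =
  S: strict_2category C + T: strict_2category D
  for C :: "('o, 'a, 'c, 'm) two_cat_scheme" and D :: "('p, 'b, 'd, 'n) two_cat_scheme" +
  fixes F :: "('o, 'a, 'c, 'p, 'b, 'd) two_functor"
  assumes obj: "X \<in> Obj C \<Longrightarrow> on_obj F X \<in> Obj D"
    and arr: "f \<in> hom C X Y \<Longrightarrow> on_arr F f \<in> hom D (on_obj F X) (on_obj F Y)"
    and cell: "\<phi> \<in> cells C f g \<Longrightarrow> on_cell F \<phi> \<in> cells D (on_arr F f) (on_arr F g)"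
    and pres_id1: "X \<in> Obj C \<Longrightarrow> on_arr F (id1 C X) = id1 D (on_obj F X)"
    and pres_comp1: "\<lbrakk>f \<in> hom C X Y; g \<in> hom C Y Z\<rbrakk> \<Longrightarrow>
      on_arr F (f \<star>\<^sub>1\<^bsub>C\<^esub> g) = on_arr F f \<star>\<^sub>1\<^bsub>D\<^esub> on_arr F g"
    and pres_id2: "f \<in> Arr C \<Longrightarrow> on_cell F (id2 C f) = id2 D (on_arr F f)"
    and pres_vcomp: "\<lbrakk>\<phi> \<in> cells C f g; \<psi> \<in> cells C g h\<rbrakk> \<Longrightarrow>
      on_cell F (\<phi> \<bullet>\<^bsub>C\<^esub> \<psi>) = on_cell F \<phi> \<bullet>\<^bsub>D\<^esub> on_cell F \<psi>"
    and pres_hcomp: "\<lbrakk>\<phi> \<in> cells C f f'; \<psi> \<in> cells C g g'; tgt C f = src C g\<rbrakk> \<Longrightarrow>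
      on_cell F (\<phi> \<star>\<^sub>2\<^bsub>C\<^esub> \<psi>) = on_cell F \<phi> \<star>\<^sub>2\<^bsub>D\<^esub> on_cell F \<psi>"

definition id_2functor :: "('o, 'a, 'c, 'o, 'a, 'c) two_functor" where
  "id_2functor = \<lparr>on_obj = (\<lambda>X. X), on_arr = (\<lambda>f. f), on_cell = (\<lambda>\<phi>. \<phi>)\<rparr>"

definition fully_faithful_2functor ::
  "('o, 'a, 'c, 'm) two_cat_scheme \<Rightarrow> ('p, 'b, 'd, 'n) two_cat_scheme \<Rightarrow>
   ('o, 'a, 'c, 'p, 'b, 'd) two_functor \<Rightarrow> bool" where
  "fully_faithful_2functor C D F \<longleftrightarrow>
     (\<forall>X\<in>Obj C. \<forall>Y\<in>Obj C.
        cat_equivalence (hom_cat C X Y) (hom_cat D (on_obj F X) (on_obj F Y))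
          \<lparr>fobj = on_arr F, farr = on_cell F\<rparr>)"

text \<open>A pseudo-natural transformation \<open>F \<Rightarrow> G\<close> has arrow components \<open>\<sigma> X : F X \<rightarrow> G X\<close> and
  invertible 2-cell components \<open>\<tau> f : F f # \<sigma> Y \<Rightarrow> \<sigma> X # G f\<close>.\<close>

definition pseudonatural ::
  "('o, 'a, 'c, 'm) two_cat_scheme \<Rightarrow> ('p, 'b, 'd, 'n) two_cat_scheme \<Rightarrow>
   ('o, 'a, 'c, 'p, 'b, 'd) two_functor \<Rightarrow> ('o, 'a, 'c, 'p, 'b, 'd) two_functor \<Rightarrow>
   ('o \<Rightarrow> 'b) \<Rightarrow> ('a \<Rightarrow> 'd) \<Rightarrow> bool" where
  "pseudonatural C D F G \<sigma> \<tau> \<longleftrightarrow>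
     (\<forall>X\<in>Obj C. \<sigma> X \<in> hom D (on_obj F X) (on_obj G X)) \<and>
     (\<forall>X\<in>Obj C. \<forall>Y\<in>Obj C. \<forall>f\<in>hom C X Y.
        \<tau> f \<in> cells D (on_arr F f \<star>\<^sub>1\<^bsub>D\<^esub> \<sigma> Y) (\<sigma> X \<star>\<^sub>1\<^bsub>D\<^esub> on_arr G f) \<and> invertible_cell D (\<tau> f)) \<and>
     (\<forall>X\<in>Obj C. \<tau> (id1 C X) = id2 D (\<sigma> X)) \<and>
     (\<forall>X\<in>Obj C. \<forall>Y\<in>Obj C. \<forall>Z\<in>Obj C. \<forall>f\<in>hom C X Y. \<forall>g\<in>hom C Y Z.
        \<tau> (f \<star>\<^sub>1\<^bsub>C\<^esub> g) =
          (id2 D (on_arr F f) \<star>\<^sub>2\<^bsub>D\<^esub> \<tau> g) \<bullet>\<^bsub>D\<^esub> (\<tau> f \<star>\<^sub>2\<^bsub>D\<^esub> id2 D (on_arr G g))) \<and>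
     (\<forall>X\<in>Obj C. \<forall>Y\<in>Obj C. \<forall>f\<in>hom C X Y. \<forall>g\<in>hom C X Y. \<forall>\<phi>\<in>cells C f g.
        (on_cell F \<phi> \<star>\<^sub>2\<^bsub>D\<^esub> id2 D (\<sigma> Y)) \<bullet>\<^bsub>D\<^esub> \<tau> g =
          \<tau> f \<bullet>\<^bsub>D\<^esub> (id2 D (\<sigma> X) \<star>\<^sub>2\<^bsub>D\<^esub> on_cell G \<phi>))"


section \<open>Semi-monoidal 2-categories and unit objects\<close>

record ('o, 'a, 'c) semi_monoidal_2cat = "('o, 'a, 'c) two_cat" +
  tensor :: "('o \<times> 'o, 'a \<times> 'a, 'c \<times> 'c, 'o, 'a, 'c) two_functor"

abbreviation tensor_obj ::
  "('o, 'a, 'c) semi_monoidal_2cat \<Rightarrow> 'o \<Rightarrow> 'o \<Rightarrow> 'o"  (infixl "\<otimes>\<^sub>0\<index>" 80) where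
  "X \<otimes>\<^sub>0\<^bsub>C\<^esub> Y \<equiv> on_obj (tensor C) (X, Y)"

abbreviation tensor_arr ::
  "('o, 'a, 'c) semi_monoidal_2cat \<Rightarrow> 'a \<Rightarrow> 'a \<Rightarrow> 'a"  (infixl "\<otimes>\<^sub>1\<index>" 80) where
  "f \<otimes>\<^sub>1\<^bsub>C\<^esub> g \<equiv> on_arr (tensor C) (f, g)"

abbreviation tensor_cell ::
  "('o, 'a, 'c) semi_monoidal_2cat \<Rightarrow> 'c \<Rightarrow> 'c \<Rightarrow> 'c"  (infixl "\<otimes>\<^sub>2\<index>" 80) where
  "\<phi> \<otimes>\<^sub>2\<^bsub>C\<^esub> \<psi> \<equiv> on_cell (tensor C) (\<phi>, \<psi>)"

locale semi_monoidal_2category = strict_2category C +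
  strict_2functor "prod_2cat C C" C "tensor C"
  for C :: "('o, 'a, 'c) semi_monoidal_2cat" (structure) +
  assumes tensor_obj_assoc: "\<lbrakk>X \<in> Obj C; Y \<in> Obj C; Z \<in> Obj C\<rbrakk> \<Longrightarrow>
      (X \<otimes>\<^sub>0 Y) \<otimes>\<^sub>0 Z = X \<otimes>\<^sub>0 (Y \<otimes>\<^sub>0 Z)"
    and tensor_arr_assoc: "\<lbrakk>f \<in> Arr C; g \<in> Arr C; h \<in> Arr C\<rbrakk> \<Longrightarrow>
      (f \<otimes>\<^sub>1 g) \<otimes>\<^sub>1 h = f \<otimes>\<^sub>1 (g \<otimes>\<^sub>1 h)"
    and tensor_cell_assoc: "\<lbrakk>\<phi> \<in> Cell C; \<psi> \<in> Cell C; \<chi> \<in> Cell C\<rbrakk> \<Longrightarrow>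
      (\<phi> \<otimes>\<^sub>2 \<psi>) \<otimes>\<^sub>2 \<chi> = \<phi> \<otimes>\<^sub>2 (\<psi> \<otimes>\<^sub>2 \<chi>)"

definition left_tensor ::
  "('o, 'a, 'c) semi_monoidal_2cat \<Rightarrow> 'o \<Rightarrow> ('o, 'a, 'c, 'o, 'a, 'c) two_functor" where
  "left_tensor C I =
     \<lparr>on_obj = (\<lambda>X. I \<otimes>\<^sub>0\<^bsub>C\<^esub> X),
      on_arr = (\<lambda>f. id1 C I \<otimes>\<^sub>1\<^bsub>C\<^esub> f),
      on_cell = (\<lambda>\<phi>. id2 C (id1 C I) \<otimes>\<^sub>2\<^bsub>C\<^esub> \<phi>)\<rparr>"

definition right_tensor ::
  "('o, 'a, 'c) semi_monoidal_2cat \<Rightarrow> 'o \<Rightarrow> ('o, 'a, 'c, 'o, 'a, 'c) two_functor" where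
  "right_tensor C I =
     \<lparr>on_obj = (\<lambda>X. X \<otimes>\<^sub>0\<^bsub>C\<^esub> I),
      on_arr = (\<lambda>f. f \<otimes>\<^sub>1\<^bsub>C\<^esub> id1 C I),
      on_cell = (\<lambda>\<phi>. \<phi> \<otimes>\<^sub>2\<^bsub>C\<^esub> id2 C (id1 C I))\<rparr>"

definition cancellable :: "('o, 'a, 'c) semi_monoidal_2cat \<Rightarrow> 'o \<Rightarrow> bool" where
  "cancellable C I \<longleftrightarrow>
     fully_faithful_2functor C C (left_tensor C I) \<and> fully_faithful_2functor C C (right_tensor C I)"

definition unit_object :: "('o, 'a, 'c) semi_monoidal_2cat \<Rightarrow> 'o \<Rightarrow> 'a \<Rightarrow> bool" where
  "unit_object C I \<alpha> \<longleftrightarrow>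
     I \<in> Obj C \<and> cancellable C I \<and> \<alpha> \<in> hom C (I \<otimes>\<^sub>0\<^bsub>C\<^esub> I) I \<and> equi_arrow C \<alpha>"

definition left_unit_pair ::
  "('o, 'a, 'c) semi_monoidal_2cat \<Rightarrow> 'o \<Rightarrow> 'a \<Rightarrow> 'o \<Rightarrow> 'a \<Rightarrow> 'c \<Rightarrow> bool" where
  "left_unit_pair C I \<alpha> X l L \<longleftrightarrow>
     l \<in> hom C (I \<otimes>\<^sub>0\<^bsub>C\<^esub> X) X \<and> equi_arrow C l \<and>
     L \<in> cells C (id1 C I \<otimes>\<^sub>1\<^bsub>C\<^esub> l) (\<alpha> \<otimes>\<^sub>1\<^bsub>C\<^esub> id1 C X) \<and> invertible_cell C L"

definition right_unit_pair ::
  "('o, 'a, 'c) semi_monoidal_2cat \<Rightarrow> 'o \<Rightarrow> 'a \<Rightarrow> 'o \<Rightarrow> 'a \<Rightarrow> 'c \<Rightarrow> bool" where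
  "right_unit_pair C I \<alpha> X r R \<longleftrightarrow>
     r \<in> hom C (X \<otimes>\<^sub>0\<^bsub>C\<^esub> I) X \<and> equi_arrow C r \<and>
     R \<in> cells C (id1 C X \<otimes>\<^sub>1\<^bsub>C\<^esub> \<alpha>) (r \<otimes>\<^sub>1\<^bsub>C\<^esub> id1 C I) \<and> invertible_cell C R"

text \<open>\<open>(I \<lambda>\<^sub>f) \<bullet> (L\<^sub>X # I f) = I I f # L\<^sub>Y\<close> and \<open>R\<^sub>X # f I = (f I I # R\<^sub>Y) \<bullet> (\<rho>\<^sub>f I)\<close>. The 2-cell
  components of the transformations with arrow components \<open>\<alpha> X\<close> and \<open>X \<alpha>\<close> are identities, so
  they do not appear; the composites match because the tensor product is a strict 2-functor.\<close>

definition left_modification ::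
  "('o, 'a, 'c) semi_monoidal_2cat \<Rightarrow> 'o \<Rightarrow> ('a \<Rightarrow> 'c) \<Rightarrow> ('o \<Rightarrow> 'c) \<Rightarrow> bool" where
  "left_modification C I lc L \<longleftrightarrow>
     (\<forall>X\<in>Obj C. \<forall>Y\<in>Obj C. \<forall>f\<in>hom C X Y.
        (id2 C (id1 C I) \<otimes>\<^sub>2\<^bsub>C\<^esub> lc f) \<bullet>\<^bsub>C\<^esub> (L X \<star>\<^sub>2\<^bsub>C\<^esub> id2 C (id1 C I \<otimes>\<^sub>1\<^bsub>C\<^esub> f)) =
        id2 C (id1 C I \<otimes>\<^sub>1\<^bsub>C\<^esub> (id1 C I \<otimes>\<^sub>1\<^bsub>C\<^esub> f)) \<star>\<^sub>2\<^bsub>C\<^esub> L Y)"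

definition right_modification ::
  "('o, 'a, 'c) semi_monoidal_2cat \<Rightarrow> 'o \<Rightarrow> ('a \<Rightarrow> 'c) \<Rightarrow> ('o \<Rightarrow> 'c) \<Rightarrow> bool" where
  "right_modification C I rc R \<longleftrightarrow>
     (\<forall>X\<in>Obj C. \<forall>Y\<in>Obj C. \<forall>f\<in>hom C X Y.
        R X \<star>\<^sub>2\<^bsub>C\<^esub> id2 C (f \<otimes>\<^sub>1\<^bsub>C\<^esub> id1 C I) =
        (id2 C ((f \<otimes>\<^sub>1\<^bsub>C\<^esub> id1 C I) \<otimes>\<^sub>1\<^bsub>C\<^esub> id1 C I) \<star>\<^sub>2\<^bsub>C\<^esub> R Y) \<bullet>\<^bsub>C\<^esub>
          (rc f \<otimes>\<^sub>2\<^bsub>C\<^esub> id2 C (id1 C I)))"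

end

theory Submission
  imports Defs
begin

text \<open>Both halves are instances of one statement about a fully faithful 2-endofunctor \<open>F\<close> and a
  strict 2-natural transformation \<open>A : F F \<Rightarrow> F\<close> whose components are equi-arrows. For the left
  constraint \<open>F X = I X\<close> and \<open>A X = \<alpha> X\<close>, for the right one \<open>F X = X I\<close> and \<open>A X = X \<alpha>\<close>.
  Essential surjectivity of \<open>F\<close> on hom categories lifts \<open>A X\<close> to \<open>l X : F X \<rightarrow> X\<close> with an
  invertible \<open>L X : F (l X) \<Rightarrow> A X\<close>, and \<open>l X\<close> is an equi-arrow because \<open>F\<close> reflects them.
  As \<open>L X\<close> is invertible, the modification equation determines the image under \<open>F\<close> of the
  2-cell to be put on each arrow. So full faithfulness on 2-cells gives existence and
  uniqueness of that 2-cell, and every naturality law can be checked after applying \<open>F\<close> and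
  composing with a whiskering of \<open>L X\<close>.\<close>

section \<open>Equivalences of categories\<close>

text \<open>The record \<open>cat\<close> is bare data and \<open>is_functor\<close> asks for no
  axioms on its source or target, so the laws used to cancel isomorphisms are collected here and
  later verified for \<open>hom_cat\<close>.\<close>

locale category =
  fixes A :: "('o, 'a) cat"
  assumes dom_cod: "u \<in> carr A \<Longrightarrow> cdom A u \<in> cobj A \<and> ccod A u \<in> cobj A"
    and cid: "x \<in> cobj A \<Longrightarrow> cid A x \<in> carr A \<and> cdom A (cid A x) = x \<and> ccod A (cid A x) = x"
    and ccomp: "\<lbrakk>u \<in> carr A; v \<in> carr A; ccod A u = cdom A v\<rbrakk> \<Longrightarrow>
      ccomp A u v \<in> carr A \<and> cdom A (ccomp A u v) = cdom A u \<and> ccod A (ccomp A u v) = ccod A v"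
    and cid_left: "u \<in> carr A \<Longrightarrow> ccomp A (cid A (cdom A u)) u = u"
    and cid_right: "u \<in> carr A \<Longrightarrow> ccomp A u (cid A (ccod A u)) = u"
    and ccomp_assoc: "\<lbrakk>u \<in> carr A; v \<in> carr A; w \<in> carr A; ccod A u = cdom A v; ccod A v = cdom A w\<rbrakk>
      \<Longrightarrow> ccomp A (ccomp A u v) w = ccomp A u (ccomp A v w)"
begin

lemma iso_inverse:
  assumes "cat_iso A e"
  obtains e' where "e' \<in> carr A" "cdom A e' = ccod A e" "ccod A e' = cdom A e"
    "ccomp A e e' = cid A (cdom A e)" "ccomp A e' e = cid A (ccod A e)" "e \<in> carr A"
  using assms unfolding cat_iso_def by blast

lemma iso_cancel_right:
  assumes e: "cat_iso A e" and u: "u \<in> carr A" "v \<in> carr A" "ccod A u = cdom A e" "ccod A v = cdom A e"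
    and eq: "ccomp A u e = ccomp A v e"
  shows "u = v"
proof -
  from e obtain e' where e': "e' \<in> carr A" "cdom A e' = ccod A e" "ccomp A e e' = cid A (cdom A e)" "e \<in> carr A"
    by (rule iso_inverse)
  have "u = ccomp A (ccomp A u e) e'"
    using u e' ccomp_assoc[of u e e'] cid_right[of u] by simp
  also have "\<dots> = v"
    using u e' ccomp_assoc[of v e e'] cid_right[of v] eq by simp
  finally show ?thesis .
qed

lemma iso_cancel_left:
  assumes e: "cat_iso A e" and u: "u \<in> carr A" "v \<in> carr A" "cdom A u = ccod A e" "cdom A v = ccod A e"
    and eq: "ccomp A e u = ccomp A e v"
  shows "u = v"
proof -
  from e obtain e' where e': "e' \<in> carr A" "ccod A e' = cdom A e" "ccomp A e' e = cid A (ccod A e)" "e \<in> carr A"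
    by (rule iso_inverse)
  have "u = ccomp A e' (ccomp A e u)"
    using u e' ccomp_assoc[of e' e u] cid_left[of u] by simp
  also have "\<dots> = v"
    using u e' ccomp_assoc[of e' e v] cid_left[of v] eq by simp
  finally show ?thesis .
qed

end

text \<open>The unit \<eta> and the counit \<epsilon> are two unrelated natural isomorphisms. No
  triangle identity comes with them, so each is used below only through naturality and
  cancellation.\<close>

lemma cat_equivalenceE:
  assumes "cat_equivalence A B F"
  obtains G \<eta> \<epsilon> where "is_functor A B F" "is_functor B A G"
    "\<forall>x\<in>cobj A. cat_iso A (\<eta> x) \<and> cdom A (\<eta> x) = x \<and> ccod A (\<eta> x) = fobj G (fobj F x)"
    "\<forall>u\<in>carr A. ccomp A u (\<eta> (ccod A u)) = ccomp A (\<eta> (cdom A u)) (farr G (farr F u))"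
    "\<forall>x\<in>cobj B. cat_iso B (\<epsilon> x) \<and> cdom B (\<epsilon> x) = fobj F (fobj G x) \<and> ccod B (\<epsilon> x) = x"
    "\<forall>u\<in>carr B. ccomp B (farr F (farr G u)) (\<epsilon> (ccod B u)) = ccomp B (\<epsilon> (cdom B u)) u"
  using assms
  unfolding cat_equivalence_def naturally_isomorphic_def id_functor_def comp_functor_def
  by simp blast

text \<open>Naturality of the unit expresses \<open>u\<close> followed by an isomorphism through
  \<open>farr G (farr F u)\<close> and the endpoints of \<open>u\<close>. Equal images therefore
  give equal arrows once the isomorphism is cancelled.\<close>

lemma cat_equivalence_faithful:
  assumes A: "category A" and F: "cat_equivalence A B F"
    and u: "u \<in> carr A" "v \<in> carr A" "cdom A u = cdom A v" "ccod A u = ccod A v"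
    and eq: "farr F u = farr F v"
  shows "u = v"
proof -
  interpret A: category A by fact
  from F obtain G \<eta> where "is_functor B A G" and \<eta>: "\<forall>x\<in>cobj A. cat_iso A (\<eta> x) \<and> cdom A (\<eta> x) = x"
    and nat: "\<forall>w\<in>carr A. ccomp A w (\<eta> (ccod A w)) = ccomp A (\<eta> (cdom A w)) (farr G (farr F w))"
    by (rule cat_equivalenceE) blast
  show ?thesis
    by (rule A.iso_cancel_right[of "\<eta> (ccod A u)"])
      (use A.dom_cod u \<eta> bspec[OF nat u(1)] bspec[OF nat u(2)] eq in auto)
qed

text \<open>The candidate \<open>u\<close> is \<open>farr G w\<close> conjugated by the unit.
  Naturality of the unit shows that \<open>farr F u\<close> and \<open>w\<close> have the same image
  under \<open>G\<close>, and naturality of the counit makes \<open>G\<close> injective on parallel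
  arrows.\<close>

lemma cat_equivalence_full:
  assumes A: "category A" and B: "category B" and F: "cat_equivalence A B F"
    and x: "x \<in> cobj A" "y \<in> cobj A"
    and w: "w \<in> carr B" "cdom B w = fobj F x" "ccod B w = fobj F y"
  obtains u where "u \<in> carr A" "cdom A u = x" "ccod A u = y" "farr F u = w"
proof -
  interpret A: category A by fact
  interpret B: category B by fact
  from F obtain G \<eta> \<epsilon> where FF: "is_functor A B F" and GF: "is_functor B A G"
    and \<eta>: "\<And>x. x \<in> cobj A \<Longrightarrow>
      cat_iso A (\<eta> x) \<and> cdom A (\<eta> x) = x \<and> ccod A (\<eta> x) = fobj G (fobj F x)"
    and nat: "\<And>w. w \<in> carr A \<Longrightarrow>
      ccomp A w (\<eta> (ccod A w)) = ccomp A (\<eta> (cdom A w)) (farr G (farr F w))"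
    and \<epsilon>: "\<And>x. x \<in> cobj B \<Longrightarrow>
      cat_iso B (\<epsilon> x) \<and> cdom B (\<epsilon> x) = fobj F (fobj G x) \<and> ccod B (\<epsilon> x) = x"
    and natB: "\<And>w. w \<in> carr B \<Longrightarrow>
      ccomp B (farr F (farr G w)) (\<epsilon> (ccod B w)) = ccomp B (\<epsilon> (cdom B w)) w"
    by (rule cat_equivalenceE) blast
  have Gw: "farr G w \<in> carr A" "cdom A (farr G w) = fobj G (fobj F x)"
    "ccod A (farr G w) = fobj G (fobj F y)"
    using GF w unfolding is_functor_def by auto
  \<comment> \<open>\<open>e\<close> is the inverse of \<open>\<eta> y\<close>. The equation kept is
    the one that cancels when \<open>u\<close> is followed by \<open>\<eta> y\<close>.\<close>
  from \<eta>[OF x(2)] obtain e where e: "e \<in> carr A" "cdom A e = fobj G (fobj F y)" "ccod A e = y"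
    "ccomp A e (\<eta> y) = cid A (fobj G (fobj F y))"
    by (metis A.iso_inverse)
  have \<eta>c: "\<eta> x \<in> carr A" "\<eta> y \<in> carr A"
    using \<eta> x unfolding cat_iso_def by auto
  define u where "u = ccomp A (ccomp A (\<eta> x) (farr G w)) e"
  have \<eta>w: "ccomp A (\<eta> x) (farr G w) \<in> carr A" "cdom A (ccomp A (\<eta> x) (farr G w)) = x"
    "ccod A (ccomp A (\<eta> x) (farr G w)) = fobj G (fobj F y)"
    using A.ccomp[of "\<eta> x" "farr G w"] \<eta>c \<eta> x Gw by auto
  then have u: "u \<in> carr A" "cdom A u = x" "ccod A u = y"
    using A.ccomp[of _ e] e unfolding u_def by auto
  have Fu: "farr F u \<in> carr B" "cdom B (farr F u) = fobj F x" "ccod B (farr F u) = fobj F y"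
    using FF u unfolding is_functor_def by auto
  have GFu: "farr G (farr F u) \<in> carr A" "cdom A (farr G (farr F u)) = fobj G (fobj F x)"
    "ccod A (farr G (farr F u)) = fobj G (fobj F y)"
    using GF Fu unfolding is_functor_def by auto
  have "ccomp A u (\<eta> y) = ccomp A (ccomp A (\<eta> x) (farr G w)) (ccomp A e (\<eta> y))"
    unfolding u_def using \<eta>w e \<eta>c \<eta> x by (intro A.ccomp_assoc) auto
  also have "\<dots> = ccomp A (\<eta> x) (farr G w)"
    using A.cid_right[OF \<eta>w(1)] \<eta>w e by simp
  finally have "ccomp A (\<eta> x) (farr G (farr F u)) = ccomp A (\<eta> x) (farr G w)"
    using nat[OF u(1)] u by simp
  then have eqG: "farr G (farr F u) = farr G w"
    using A.iso_cancel_left[of "\<eta> x"] \<eta> x GFu Gw by simp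
  \<comment> \<open>Preceded by the counit at \<open>fobj F x\<close>, both arrows become the image
    of \<open>farr G w\<close> under \<open>F\<close> followed by the counit at
    \<open>fobj F y\<close>, thanks to \<open>eqG\<close>.\<close>
  have "farr F u = w"
    by (rule B.iso_cancel_left[of "\<epsilon> (fobj F x)"])
      (use natB[OF w(1)] natB[OF Fu(1)] B.dom_cod[OF w(1)] \<epsilon> w Fu eqG in auto)
  with u that show ?thesis by blast
qed

lemma cat_equivalence_ess_surj:
  assumes F: "cat_equivalence A B F" and y: "y \<in> cobj B"
  obtains x e where "x \<in> cobj A" "cat_iso B e" "cdom B e = fobj F x" "ccod B e = y"
proof -
  from F obtain G \<epsilon> where G: "is_functor B A G" and \<epsilon>: "\<And>x. x \<in> cobj B \<Longrightarrow>
      cat_iso B (\<epsilon> x) \<and> cdom B (\<epsilon> x) = fobj F (fobj G x) \<and> ccod B (\<epsilon> x) = x"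
    by (rule cat_equivalenceE) blast
  show ?thesis
    by (rule that[of "fobj G y" "\<epsilon> y"]) (use G \<epsilon>[OF y] y in \<open>auto simp: is_functor_def\<close>)
qed


section \<open>Invertible 2-cells and equi-arrows\<close>

text \<open>Hiding the 2-cell turns arguments about pseudo-inverses into reasoning with an
  equivalence relation compatible with \<open>comp1\<close>. \<open>equi_arrow_iff\<close> puts
  equi-arrows in these terms.\<close>

definition isomorphic_arrows :: "('o, 'a, 'c, 'm) two_cat_scheme \<Rightarrow> 'a \<Rightarrow> 'a \<Rightarrow> bool" where
  "isomorphic_arrows C f g \<longleftrightarrow> (\<exists>\<phi>\<in>cells C f g. invertible_cell C \<phi>)"

lemma equi_arrow_iff:
  assumes "f \<in> hom C X Y"
  shows "equi_arrow C f \<longleftrightarrow>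
    (\<exists>g\<in>hom C Y X. isomorphic_arrows C (f \<star>\<^sub>1\<^bsub>C\<^esub> g) (id1 C X) \<and>
      isomorphic_arrows C (g \<star>\<^sub>1\<^bsub>C\<^esub> f) (id1 C Y))"
  using assms unfolding equi_arrow_def isomorphic_arrows_def hom_def by auto

context strict_2category
begin

lemma homD: "f \<in> hom C X Y \<Longrightarrow> X \<in> Obj C \<and> Y \<in> Obj C \<and> f \<in> Arr C \<and> src C f = X \<and> tgt C f = Y"
  unfolding hom_def using src_tgt by auto

lemma cellsD: "\<phi> \<in> cells C f g \<Longrightarrow> \<phi> \<in> Cell C \<and> f \<in> Arr C \<and> g \<in> Arr C \<and> dom2 C \<phi> = f \<and> cod2 C \<phi> = g"
  unfolding cells_def using dom2_cod2 by auto

lemma cells_hom: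
  "\<lbrakk>\<phi> \<in> cells C f g; f \<in> hom C X Y\<rbrakk> \<Longrightarrow> g \<in> hom C X Y"
  "\<lbrakk>\<phi> \<in> cells C f g; g \<in> hom C X Y\<rbrakk> \<Longrightarrow> f \<in> hom C X Y"
  unfolding hom_def cells_def using parallel dom2_cod2 by auto

lemma id2_cells_hom: "f \<in> hom C X Y \<Longrightarrow> id2 C f \<in> cells C f f"
  using id2_cells homD by blast

text \<open>The locale axioms match composable arrows by \<open>tgt C f = src C g\<close>. This
  lemma and the next two take membership in hom sets instead, so that boundaries can be supplied
  with \<open>OF\<close>.\<close>

lemma hcomp_cells_hom:
  "\<lbrakk>\<phi> \<in> cells C f f'; \<psi> \<in> cells C g g'; f \<in> hom C X Y; g \<in> hom C Y Z\<rbrakk> \<Longrightarrow>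
    \<phi> \<star>\<^sub>2 \<psi> \<in> cells C (f \<star>\<^sub>1 g) (f' \<star>\<^sub>1 g')"
  by (rule hcomp_cells) (auto dest: homD)

lemma interchange_hom:
  "\<lbrakk>\<phi> \<in> cells C f f'; \<phi>' \<in> cells C f' f''; \<psi> \<in> cells C g g'; \<psi>' \<in> cells C g' g'';
    f \<in> hom C X Y; g \<in> hom C Y Z\<rbrakk> \<Longrightarrow>
   (\<phi> \<bullet> \<phi>') \<star>\<^sub>2 (\<psi> \<bullet> \<psi>') = (\<phi> \<star>\<^sub>2 \<psi>) \<bullet> (\<phi>' \<star>\<^sub>2 \<psi>')"
  by (rule interchange) (auto dest: homD)

lemma hcomp_assoc_hom:
  "\<lbrakk>\<phi> \<in> cells C f f'; \<psi> \<in> cells C g g'; \<chi> \<in> cells C h h';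
    f \<in> hom C W X; g \<in> hom C X Y; h \<in> hom C Y Z\<rbrakk> \<Longrightarrow>
   (\<phi> \<star>\<^sub>2 \<psi>) \<star>\<^sub>2 \<chi> = \<phi> \<star>\<^sub>2 (\<psi> \<star>\<^sub>2 \<chi>)"
  by (rule hcomp_assoc) (auto dest: homD)

lemma whisker_left_vcomp:
  assumes "h \<in> hom C W X" "f \<in> hom C X Y" "\<phi> \<in> cells C f g" "\<psi> \<in> cells C g k"
  shows "id2 C h \<star>\<^sub>2 (\<phi> \<bullet> \<psi>) = (id2 C h \<star>\<^sub>2 \<phi>) \<bullet> (id2 C h \<star>\<^sub>2 \<psi>)"
  using interchange_hom[OF id2_cells_hom[OF assms(1)] id2_cells_hom[OF assms(1)] assms(3,4,1,2)]
    id2_left[OF id2_cells_hom[OF assms(1)]] by simp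

lemma whisker_right_vcomp:
  assumes "h \<in> hom C Y Z" "f \<in> hom C X Y" "\<phi> \<in> cells C f g" "\<psi> \<in> cells C g k"
  shows "(\<phi> \<bullet> \<psi>) \<star>\<^sub>2 id2 C h = (\<phi> \<star>\<^sub>2 id2 C h) \<bullet> (\<psi> \<star>\<^sub>2 id2 C h)"
  using interchange_hom[OF assms(3,4) id2_cells_hom[OF assms(1)] id2_cells_hom[OF assms(1)] assms(2,1)]
    id2_left[OF id2_cells_hom[OF assms(1)]] by simp

text \<open>Interchange with identities inserted in the two factors, here in one order and in the
  next lemma in the other. Equating the two splittings slides one 2-cell past another.\<close>

lemma hcomp_left_then_right:
  assumes "\<phi> \<in> cells C f f'" "\<psi> \<in> cells C g g'" "f \<in> hom C X Y" "g \<in> hom C Y Z"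
  shows "(\<phi> \<star>\<^sub>2 id2 C g) \<bullet> (id2 C f' \<star>\<^sub>2 \<psi>) = \<phi> \<star>\<^sub>2 \<psi>"
  using interchange_hom[of \<phi> f f' "id2 C f'" f' "id2 C g" g g \<psi> g' X Y Z] assms cellsD id2_cells
    id2_left[OF assms(2)] id2_right[OF assms(1)] by metis

lemma hcomp_right_then_left:
  assumes "\<phi> \<in> cells C f f'" "\<psi> \<in> cells C g g'" "f \<in> hom C X Y" "g \<in> hom C Y Z"
  shows "(id2 C f \<star>\<^sub>2 \<psi>) \<bullet> (\<phi> \<star>\<^sub>2 id2 C g') = \<phi> \<star>\<^sub>2 \<psi>"
  using interchange_hom[of "id2 C f" f f \<phi> f' \<psi> g g' "id2 C g'" g' X Y Z] assms cellsD id2_cells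
    id2_right[OF assms(2)] id2_left[OF assms(1)] by metis

lemma invertible_cellI:
  assumes "\<phi> \<in> cells C f g" "\<psi> \<in> cells C g f" "\<phi> \<bullet> \<psi> = id2 C f" "\<psi> \<bullet> \<phi> = id2 C g"
  shows "invertible_cell C \<phi>"
  using assms cellsD unfolding invertible_cell_def by metis

lemma invertible_cellE:
  assumes "invertible_cell C \<phi>" "\<phi> \<in> cells C f g"
  obtains \<psi> where "\<psi> \<in> cells C g f" "\<phi> \<bullet> \<psi> = id2 C f" "\<psi> \<bullet> \<phi> = id2 C g" "invertible_cell C \<psi>"
proof -
  obtain \<psi> where \<psi>: "\<psi> \<in> cells C g f" "\<phi> \<bullet> \<psi> = id2 C f" "\<psi> \<bullet> \<phi> = id2 C g"
    using assms cellsD unfolding invertible_cell_def by metis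
  then have "invertible_cell C \<psi>" using assms(2) by (intro invertible_cellI)
  with \<psi> that show ?thesis by blast
qed

lemma invertible_id2: "f \<in> Arr C \<Longrightarrow> invertible_cell C (id2 C f)"
  by (meson id2_cells id2_left invertible_cellI)

lemma invertible_vcomp:
  assumes "\<phi> \<in> cells C f g" "invertible_cell C \<phi>" "\<psi> \<in> cells C g h" "invertible_cell C \<psi>"
  shows "invertible_cell C (\<phi> \<bullet> \<psi>)"
proof -
  obtain \<phi>' where \<phi>': "\<phi>' \<in> cells C g f" "\<phi> \<bullet> \<phi>' = id2 C f" "\<phi>' \<bullet> \<phi> = id2 C g"
    using assms invertible_cellE by blast
  obtain \<psi>' where \<psi>': "\<psi>' \<in> cells C h g" "\<psi> \<bullet> \<psi>' = id2 C g" "\<psi>' \<bullet> \<psi> = id2 C h"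
    using assms invertible_cellE by blast
  note c = assms(1,3) \<phi>'(1) \<psi>'(1)
  have "(\<phi> \<bullet> \<psi>) \<bullet> (\<psi>' \<bullet> \<phi>') = \<phi> \<bullet> ((\<psi> \<bullet> \<psi>') \<bullet> \<phi>')"
    using vcomp_assoc[OF c(1,2) vcomp_cells[OF c(4,3)]] vcomp_assoc[OF c(2,4,3)] by simp
  also have "\<dots> = id2 C f" using \<phi>' \<psi>' id2_left by simp
  finally have 1: "(\<phi> \<bullet> \<psi>) \<bullet> (\<psi>' \<bullet> \<phi>') = id2 C f" .
  have "(\<psi>' \<bullet> \<phi>') \<bullet> (\<phi> \<bullet> \<psi>) = \<psi>' \<bullet> ((\<phi>' \<bullet> \<phi>) \<bullet> \<psi>)"
    using vcomp_assoc[OF c(4,3) vcomp_cells[OF c(1,2)]] vcomp_assoc[OF c(3,1,2)] by simp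
  also have "\<dots> = id2 C h" using \<phi>' \<psi>' assms id2_left by simp
  finally show ?thesis using 1 c vcomp_cells by (blast intro: invertible_cellI)
qed

lemma invertible_hcomp:
  assumes "\<phi> \<in> cells C f f'" "invertible_cell C \<phi>" "\<psi> \<in> cells C g g'" "invertible_cell C \<psi>"
    and h: "f \<in> hom C X Y" "g \<in> hom C Y Z"
  shows "invertible_cell C (\<phi> \<star>\<^sub>2 \<psi>)"
proof -
  obtain \<phi>' where \<phi>': "\<phi>' \<in> cells C f' f" "\<phi> \<bullet> \<phi>' = id2 C f" "\<phi>' \<bullet> \<phi> = id2 C f'"
    using assms invertible_cellE by blast
  obtain \<psi>' where \<psi>': "\<psi>' \<in> cells C g' g" "\<psi> \<bullet> \<psi>' = id2 C g" "\<psi>' \<bullet> \<psi> = id2 C g'"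
    using assms invertible_cellE by blast
  note c = assms(1,3) \<phi>'(1) \<psi>'(1)
  have h': "f' \<in> hom C X Y" "g' \<in> hom C Y Z"
    using cells_hom(1)[OF c(1) h(1)] cells_hom(1)[OF c(2) h(2)] by simp_all
  show ?thesis
  proof (rule invertible_cellI)
    show "\<phi> \<star>\<^sub>2 \<psi> \<in> cells C (f \<star>\<^sub>1 g) (f' \<star>\<^sub>1 g')" "\<phi>' \<star>\<^sub>2 \<psi>' \<in> cells C (f' \<star>\<^sub>1 g') (f \<star>\<^sub>1 g)"
      using hcomp_cells_hom[OF c(1,2) h] hcomp_cells_hom[OF c(3,4) h'] by simp_all
    show "(\<phi> \<star>\<^sub>2 \<psi>) \<bullet> (\<phi>' \<star>\<^sub>2 \<psi>') = id2 C (f \<star>\<^sub>1 g)"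
      using interchange_hom[OF c(1,3,2,4) h] \<phi>' \<psi>' hcomp_id2[OF h] by simp
    show "(\<phi>' \<star>\<^sub>2 \<psi>') \<bullet> (\<phi> \<star>\<^sub>2 \<psi>) = id2 C (f' \<star>\<^sub>1 g')"
      using interchange_hom[OF c(3,1,4,2) h'] \<phi>' \<psi>' hcomp_id2[OF h'] by simp
  qed
qed

lemma vcomp_cancel_right:
  assumes "\<phi> \<in> cells C f g" "\<phi>' \<in> cells C f g" "\<psi> \<in> cells C g h" "invertible_cell C \<psi>"
    and eq: "\<phi> \<bullet> \<psi> = \<phi>' \<bullet> \<psi>"
  shows "\<phi> = \<phi>'"
proof -
  obtain \<psi>' where \<psi>': "\<psi>' \<in> cells C h g" "\<psi> \<bullet> \<psi>' = id2 C g"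
    using assms invertible_cellE by blast
  have "\<phi> = (\<phi> \<bullet> \<psi>) \<bullet> \<psi>'"
    using vcomp_assoc[OF assms(1,3) \<psi>'(1)] \<psi>'(2) id2_right[OF assms(1)] by simp
  also have "\<dots> = \<phi>'"
    unfolding eq using vcomp_assoc[OF assms(2,3) \<psi>'(1)] \<psi>'(2) id2_right[OF assms(2)] by simp
  finally show ?thesis .
qed

text \<open>Multiply by inverses on both sides. The lemma serves to pass between a modification law
  written with the inverses of the 2-cells \<open>R X\<close> and the law for \<open>R\<close>
  itself.\<close>

lemma inverse_swap:
  assumes \<phi>: "\<phi> \<in> cells C p q"
    and s: "s \<in> cells C q k" "s' \<in> cells C k q" "s \<bullet> s' = id2 C q" "s' \<bullet> s = id2 C k"
    and t: "t \<in> cells C p k" "t' \<in> cells C k p" "t \<bullet> t' = id2 C p" "t' \<bullet> t = id2 C k"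
  shows "\<phi> \<bullet> s = t \<longleftrightarrow> s' = t' \<bullet> \<phi>"
proof
  assume "\<phi> \<bullet> s = t"
  then have "\<phi> = t \<bullet> s'"
    using vcomp_assoc[OF \<phi> s(1,2)] s(3) id2_right[OF \<phi>] by simp
  then show "s' = t' \<bullet> \<phi>"
    using vcomp_assoc[OF t(2,1) s(2)] t(4) id2_left[OF s(2)] by simp
next
  assume "s' = t' \<bullet> \<phi>"
  then have "\<phi> = t \<bullet> s'"
    using vcomp_assoc[OF t(1,2) \<phi>] t(3) id2_left[OF \<phi>] by simp
  then show "\<phi> \<bullet> s = t"
    using vcomp_assoc[OF t(1) s(2,1)] s(4) id2_right[OF t(1)] by simp
qed

lemma isomorphic_arrows_sym: "isomorphic_arrows C f g \<Longrightarrow> isomorphic_arrows C g f"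
  unfolding isomorphic_arrows_def by (metis invertible_cellE)

lemma isomorphic_arrows_trans [trans]:
  "\<lbrakk>isomorphic_arrows C f g; isomorphic_arrows C g h\<rbrakk> \<Longrightarrow> isomorphic_arrows C f h"
  unfolding isomorphic_arrows_def by (blast intro: invertible_vcomp vcomp_cells)

lemma isomorphic_arrows_refl: "f \<in> Arr C \<Longrightarrow> isomorphic_arrows C f f"
  unfolding isomorphic_arrows_def by (blast intro: invertible_id2 id2_cells)

lemma isomorphic_arrows_comp1:
  assumes "isomorphic_arrows C f f'" "isomorphic_arrows C g g'"
    and h: "f \<in> hom C X Y" "g \<in> hom C Y Z"
  shows "isomorphic_arrows C (f \<star>\<^sub>1 g) (f' \<star>\<^sub>1 g')"
proof -
  obtain \<phi> \<psi> where "\<phi> \<in> cells C f f'" "invertible_cell C \<phi>" "\<psi> \<in> cells C g g'" "invertible_cell C \<psi>"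
    using assms unfolding isomorphic_arrows_def by blast
  from invertible_hcomp[OF this h] hcomp_cells_hom[OF this(1,3) h] show ?thesis
    unfolding isomorphic_arrows_def by blast
qed

text \<open>A pseudo-inverse of \<open>f\<close> also serves for \<open>g\<close>, because composing
  with it respects isomorphism of arrows.\<close>

lemma equi_arrow_isomorphic:
  assumes "equi_arrow C f" "f \<in> hom C X Y" "isomorphic_arrows C g f" "g \<in> hom C X Y"
  shows "equi_arrow C g"
proof -
  obtain k where k: "k \<in> hom C Y X" "isomorphic_arrows C (f \<star>\<^sub>1 k) (id1 C X)"
      "isomorphic_arrows C (k \<star>\<^sub>1 f) (id1 C Y)"
    using assms(1) unfolding equi_arrow_iff[OF assms(2)] by blast
  have "k \<in> Arr C" using k homD by blast
  then have "isomorphic_arrows C (g \<star>\<^sub>1 k) (f \<star>\<^sub>1 k)" "isomorphic_arrows C (k \<star>\<^sub>1 g) (k \<star>\<^sub>1 f)"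
    using isomorphic_arrows_comp1[OF assms(3) isomorphic_arrows_refl assms(4) k(1)]
      isomorphic_arrows_comp1[OF isomorphic_arrows_refl assms(3) k(1) assms(4)] by simp_all
  then show ?thesis
    unfolding equi_arrow_iff[OF assms(4)] using k isomorphic_arrows_trans by blast
qed

lemma category_hom_cat: "category (hom_cat C X Y)"
proof
  fix u v w
  assume u: "u \<in> carr (hom_cat C X Y)" and v: "v \<in> carr (hom_cat C X Y)"
    and uv: "ccod (hom_cat C X Y) u = cdom (hom_cat C X Y) v"
  have c: "u \<in> cells C (dom2 C u) (dom2 C v)" "v \<in> cells C (dom2 C v) (cod2 C v)"
    using u v uv unfolding hom_cat_def cells_def by auto
  have "u \<bullet> v \<in> cells C (dom2 C u) (cod2 C v)" using c by (rule vcomp_cells)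
  then show "ccomp (hom_cat C X Y) u v \<in> carr (hom_cat C X Y) \<and>
    cdom (hom_cat C X Y) (ccomp (hom_cat C X Y) u v) = cdom (hom_cat C X Y) u \<and>
    ccod (hom_cat C X Y) (ccomp (hom_cat C X Y) u v) = ccod (hom_cat C X Y) v"
    using u v unfolding hom_cat_def cells_def by auto
  assume w: "w \<in> carr (hom_cat C X Y)" and vw: "ccod (hom_cat C X Y) v = cdom (hom_cat C X Y) w"
  have "v \<in> cells C (dom2 C v) (dom2 C w)" "w \<in> cells C (dom2 C w) (cod2 C w)"
    using v w vw unfolding hom_cat_def cells_def by auto
  with c show "ccomp (hom_cat C X Y) (ccomp (hom_cat C X Y) u v) w =
    ccomp (hom_cat C X Y) u (ccomp (hom_cat C X Y) v w)"
    unfolding hom_cat_def by (simp add: vcomp_assoc)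
next
  fix x
  assume "x \<in> cobj (hom_cat C X Y)"
  then have "x \<in> hom C X Y" by (simp add: hom_cat_def)
  with id2_cells_hom[OF this] show "cid (hom_cat C X Y) x \<in> carr (hom_cat C X Y) \<and>
    cdom (hom_cat C X Y) (cid (hom_cat C X Y) x) = x \<and> ccod (hom_cat C X Y) (cid (hom_cat C X Y) x) = x"
    unfolding hom_cat_def cells_def by auto
next
  fix u
  assume u: "u \<in> carr (hom_cat C X Y)"
  then show "cdom (hom_cat C X Y) u \<in> cobj (hom_cat C X Y) \<and> ccod (hom_cat C X Y) u \<in> cobj (hom_cat C X Y)"
    unfolding hom_cat_def by auto
  have "u \<in> cells C (dom2 C u) (cod2 C u)"
    using u unfolding hom_cat_def cells_def by auto
  from id2_left[OF this] id2_right[OF this]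
  show "ccomp (hom_cat C X Y) (cid (hom_cat C X Y) (cdom (hom_cat C X Y) u)) u = u"
    "ccomp (hom_cat C X Y) u (cid (hom_cat C X Y) (ccod (hom_cat C X Y) u)) = u"
    unfolding hom_cat_def by auto
qed

lemma cat_iso_hom_cat:
  "cat_iso (hom_cat C X Y) \<phi> \<Longrightarrow> invertible_cell C \<phi>"
  unfolding cat_iso_def hom_cat_def invertible_cell_def cells_def by auto

end


section \<open>Fully faithful 2-functors\<close>

context strict_2functor
begin

section \<open>Preservation under strict 2-functors\<close>

lemma pres_invertible:
  assumes "\<phi> \<in> cells C f g" "invertible_cell C \<phi>"
  shows "invertible_cell D (on_cell F \<phi>)"
proof -
  obtain \<psi> where \<psi>: "\<psi> \<in> cells C g f" "\<phi> \<bullet>\<^bsub>C\<^esub> \<psi> = id2 C f" "\<psi> \<bullet>\<^bsub>C\<^esub> \<phi> = id2 C g"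
    using assms S.invertible_cellE by blast
  show ?thesis
    by (rule T.invertible_cellI[OF cell[OF assms(1)] cell[OF \<psi>(1)]])
      (use pres_vcomp[OF assms(1) \<psi>(1)] pres_vcomp[OF \<psi>(1) assms(1)] \<psi> assms(1)
        S.cellsD[OF assms(1)] pres_id2 in auto)
qed

lemma pres_isomorphic_arrows:
  "isomorphic_arrows C f g \<Longrightarrow> isomorphic_arrows D (on_arr F f) (on_arr F g)"
  unfolding isomorphic_arrows_def using pres_invertible cell by blast

lemma pres_equi_arrow:
  assumes "equi_arrow C f" "f \<in> hom C X Y"
  shows "equi_arrow D (on_arr F f)"
proof -
  obtain g where g: "g \<in> hom C Y X" "isomorphic_arrows C (f \<star>\<^sub>1\<^bsub>C\<^esub> g) (id1 C X)"
      "isomorphic_arrows C (g \<star>\<^sub>1\<^bsub>C\<^esub> f) (id1 C Y)"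
    using assms(1) unfolding equi_arrow_iff[OF assms(2)] by blast
  have "X \<in> Obj C" "Y \<in> Obj C" using assms S.homD by auto
  with pres_isomorphic_arrows[OF g(2)] pres_isomorphic_arrows[OF g(3)] assms g(1) show ?thesis
    unfolding equi_arrow_iff[OF arr[OF assms(2)]]
    by (intro bexI[OF _ arr[OF g(1)]]) (simp add: pres_comp1 pres_id1)
qed

section \<open>Lifting and reflection along fully faithful 2-functors\<close>

context
  assumes ff: "fully_faithful_2functor C D F"
begin

lemma hom_equivalence:
  "\<lbrakk>X \<in> Obj C; Y \<in> Obj C\<rbrakk> \<Longrightarrow> cat_equivalence (hom_cat C X Y) (hom_cat D (on_obj F X) (on_obj F Y))
          \<lparr>fobj = on_arr F, farr = on_cell F\<rparr>"
  using ff unfolding fully_faithful_2functor_def by blast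

lemma ff_faithful:
  assumes "\<phi> \<in> cells C f g" "\<psi> \<in> cells C f g" "on_cell F \<phi> = on_cell F \<psi>"
  shows "\<phi> = \<psi>"
proof -
  let ?X = "src C f" and ?Y = "tgt C f"
  have f: "f \<in> hom C ?X ?Y" using assms S.cellsD unfolding hom_def by blast
  then have "g \<in> hom C ?X ?Y" using assms S.cells_hom by blast
  with f show ?thesis
    using assms S.homD[OF f]
    by (intro cat_equivalence_faithful[OF S.category_hom_cat hom_equivalence[of ?X ?Y]])
      (auto simp: hom_cat_def cells_def)
qed

lemma ff_full:
  assumes f: "f \<in> hom C X Y" "g \<in> hom C X Y" and \<psi>: "\<psi> \<in> cells D (on_arr F f) (on_arr F g)"
  obtains \<phi> where "\<phi> \<in> cells C f g" "on_cell F \<phi> = \<psi>"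
proof -
  have X: "X \<in> Obj C" "Y \<in> Obj C" using f S.homD by auto
  show thesis
    by (rule cat_equivalence_full[OF S.category_hom_cat T.category_hom_cat hom_equivalence[OF X],
          where x = f and y = g and w = \<psi>])
      (use f \<psi> arr[OF f(1)] arr[OF f(2)] that in \<open>auto simp: hom_cat_def cells_def\<close>)
qed

lemma ff_ess_surj:
  assumes X: "X \<in> Obj C" "Y \<in> Obj C" and h: "h \<in> hom D (on_obj F X) (on_obj F Y)"
  obtains f where "f \<in> hom C X Y" "isomorphic_arrows D (on_arr F f) h"
proof -
  obtain f e where f: "f \<in> hom C X Y"
    and e: "cat_iso (hom_cat D (on_obj F X) (on_obj F Y)) e" "dom2 D e = on_arr F f" "cod2 D e = h"
    by (rule cat_equivalence_ess_surj[OF hom_equivalence[OF X], where y = h])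
      (use h in \<open>auto simp: hom_cat_def\<close>)
  have "isomorphic_arrows D (on_arr F f) h"
    using e T.cat_iso_hom_cat[OF e(1)] unfolding isomorphic_arrows_def
    by (intro bexI[of _ e]) (simp_all add: cells_def cat_iso_def hom_cat_def)
  with f that show ?thesis by blast
qed

text \<open>Fullness supplies a preimage of the inverse 2-cell, and faithfulness carries both
  inverse equations back from \<open>D\<close>.\<close>

lemma ff_reflects_invertible:
  assumes \<phi>: "\<phi> \<in> cells C f g" and "invertible_cell D (on_cell F \<phi>)"
  shows "invertible_cell C \<phi>"
proof -
  obtain \<psi>' where \<psi>': "\<psi>' \<in> cells D (on_arr F g) (on_arr F f)"
    "on_cell F \<phi> \<bullet>\<^bsub>D\<^esub> \<psi>' = id2 D (on_arr F f)" "\<psi>' \<bullet>\<^bsub>D\<^esub> on_cell F \<phi> = id2 D (on_arr F g)"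
    using assms cell T.invertible_cellE by blast
  have f: "f \<in> hom C (src C f) (tgt C f)" "f \<in> Arr C" "g \<in> Arr C"
    using \<phi> S.cellsD unfolding hom_def by auto
  have g: "g \<in> hom C (src C f) (tgt C f)" using f \<phi> S.cells_hom by blast
  obtain \<psi> where \<psi>: "\<psi> \<in> cells C g f" "on_cell F \<psi> = \<psi>'"
    using ff_full[OF g f(1) \<psi>'(1)] by blast
  show ?thesis
  proof (rule S.invertible_cellI[OF \<phi> \<psi>(1)])
    show "\<phi> \<bullet>\<^bsub>C\<^esub> \<psi> = id2 C f"
      by (rule ff_faithful[of _ f f])
        (use \<phi> \<psi> \<psi>' f in \<open>auto simp: pres_vcomp[OF \<phi> \<psi>(1)] pres_id2 intro: S.vcomp_cells S.id2_cells\<close>)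
    show "\<psi> \<bullet>\<^bsub>C\<^esub> \<phi> = id2 C g"
      by (rule ff_faithful[of _ g g])
        (use \<phi> \<psi> \<psi>' f in \<open>auto simp: pres_vcomp[OF \<psi>(1) \<phi>] pres_id2 intro: S.vcomp_cells S.id2_cells\<close>)
  qed
qed

lemma ff_reflects_isomorphic_arrows:
  assumes "f \<in> hom C X Y" "g \<in> hom C X Y" "isomorphic_arrows D (on_arr F f) (on_arr F g)"
  shows "isomorphic_arrows C f g"
proof -
  obtain \<psi> where \<psi>: "\<psi> \<in> cells D (on_arr F f) (on_arr F g)" "invertible_cell D \<psi>"
    using assms unfolding isomorphic_arrows_def by blast
  obtain \<phi> where "\<phi> \<in> cells C f g" "on_cell F \<phi> = \<psi>"
    using ff_full[OF assms(1,2) \<psi>(1)] .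
  then show ?thesis
    using \<psi> ff_reflects_invertible unfolding isomorphic_arrows_def by blast
qed

text \<open>The pseudo-inverse \<open>k\<close> need not lie in the image of \<open>F\<close>.
  Essential surjectivity replaces it by an isomorphic \<open>on_arr F g\<close>, and the
  isomorphisms with the identities are then reflected.\<close>

lemma ff_reflects_equi_arrow:
  assumes f: "f \<in> hom C X Y" and e: "equi_arrow D (on_arr F f)"
  shows "equi_arrow C f"
proof -
  have X: "X \<in> Obj C" "Y \<in> Obj C" using f S.homD by auto
  obtain k where k: "k \<in> hom D (on_obj F Y) (on_obj F X)"
      "isomorphic_arrows D (on_arr F f \<star>\<^sub>1\<^bsub>D\<^esub> k) (id1 D (on_obj F X))"
      "isomorphic_arrows D (k \<star>\<^sub>1\<^bsub>D\<^esub> on_arr F f) (id1 D (on_obj F Y))"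
    using e unfolding equi_arrow_iff[OF arr[OF f]] by blast
  obtain g where g: "g \<in> hom C Y X" "isomorphic_arrows D (on_arr F g) k"
    using ff_ess_surj[OF X(2,1) k(1)] by blast
  note Ff = arr[OF f] and Fg = arr[OF g(1)]
  have r: "isomorphic_arrows D (on_arr F f) (on_arr F f)"
    using T.isomorphic_arrows_refl Ff T.homD by blast
  have "isomorphic_arrows D (on_arr F (f \<star>\<^sub>1\<^bsub>C\<^esub> g)) (on_arr F (id1 C X))"
    using T.isomorphic_arrows_trans[OF T.isomorphic_arrows_comp1[OF r g(2) Ff Fg] k(2)]
    by (simp add: pres_comp1[OF f g(1)] pres_id1[OF X(1)])
  moreover have "isomorphic_arrows D (on_arr F (g \<star>\<^sub>1\<^bsub>C\<^esub> f)) (on_arr F (id1 C Y))"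
    using T.isomorphic_arrows_trans[OF T.isomorphic_arrows_comp1[OF g(2) r Fg Ff] k(3)]
    by (simp add: pres_comp1[OF g(1) f] pres_id1[OF X(2)])
  ultimately show ?thesis
    unfolding equi_arrow_iff[OF f]
    using g(1) X
    by (auto intro!: bexI[of _ g] ff_reflects_isomorphic_arrows S.comp1_hom[OF f] S.comp1_hom[OF _ f] S.id1_hom)
qed

end

end

section \<open>Lifting along a fully faithful 2-endofunctor\<close>

text \<open>\<open>A\<close> is strictly 2-natural, that is, its 2-cells on arrows are identities.
  Hence \<open>A_nat\<close> is an equation between arrows, and the two sides of the modification
  law end at the same arrow without a further 2-cell.\<close>

locale fully_faithful_endo = strict_2functor C C F
  for C :: "('o, 'a, 'c, 'm) two_cat_scheme" (structure)
    and F :: "('o, 'a, 'c, 'o, 'a, 'c) two_functor" +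
  fixes A :: "'o \<Rightarrow> 'a"
  assumes ff: "fully_faithful_2functor C C F"
    and A: "X \<in> Obj C \<Longrightarrow> A X \<in> hom C (on_obj F (on_obj F X)) (on_obj F X)"
    and A_nat: "f \<in> hom C X Y \<Longrightarrow> on_arr F (on_arr F f) \<star>\<^sub>1 A Y = A X \<star>\<^sub>1 on_arr F f"
    and A_nat_cell: "\<lbrakk>f \<in> hom C X Y; \<phi> \<in> cells C f g\<rbrakk> \<Longrightarrow>
      on_cell F (on_cell F \<phi>) \<star>\<^sub>2 id2 C (A Y) = id2 C (A X) \<star>\<^sub>2 on_cell F \<phi>"
begin

lemma lift_exists:
  assumes X: "X \<in> Obj C" and e: "equi_arrow C (A X)"
  obtains l where "l \<in> hom C (on_obj F X) X" "equi_arrow C l" "isomorphic_arrows C (on_arr F l) (A X)"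
proof -
  obtain l where l: "l \<in> hom C (on_obj F X) X" "isomorphic_arrows C (on_arr F l) (A X)"
    using ff_ess_surj[OF ff obj[OF X] X A[OF X]] .
  have "equi_arrow C (on_arr F l)"
    using S.equi_arrow_isomorphic[OF e A[OF X] l(2) arr[OF l(1)]] .
  from ff_reflects_equi_arrow[OF ff l(1) this] l that show ?thesis by blast
qed

end

section \<open>Arbitrary families of lifts and the 2-cells they determine on arrows\<close>

locale lifted_family = fully_faithful_endo C F A
  for C :: "('o, 'a, 'c, 'm) two_cat_scheme" (structure)
    and F :: "('o, 'a, 'c, 'o, 'a, 'c) two_functor"
    and A :: "'o \<Rightarrow> 'a" +
  fixes l :: "'o \<Rightarrow> 'a" and L :: "'o \<Rightarrow> 'c"
  assumes l: "X \<in> Obj C \<Longrightarrow> l X \<in> hom C (on_obj F X) X"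
    and L: "X \<in> Obj C \<Longrightarrow> L X \<in> cells C (on_arr F (l X)) (A X)"
    and L_inv: "X \<in> Obj C \<Longrightarrow> invertible_cell C (L X)"
begin

lemma boundary:
  assumes f: "f \<in> hom C X Y"
  shows "on_arr F f \<star>\<^sub>1 l Y \<in> hom C (on_obj F X) Y" "l X \<star>\<^sub>1 f \<in> hom C (on_obj F X) Y"
    "on_arr F (on_arr F f \<star>\<^sub>1 l Y) = on_arr F (on_arr F f) \<star>\<^sub>1 on_arr F (l Y)"
    "on_arr F (l X \<star>\<^sub>1 f) = on_arr F (l X) \<star>\<^sub>1 on_arr F f"
  using S.homD[OF f] S.comp1_hom[OF arr[OF f] l] S.comp1_hom[OF l f]
    pres_comp1[OF arr[OF f] l] pres_comp1[OF l f] by simp_all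

text \<open>The modification law says that \<open>on_cell F \<phi>\<close> followed by this 2-cell
  is the one in \<open>whiskered_target\<close>. Both are invertible and end at
  \<open>A X \<star>\<^sub>1 on_arr F f\<close>, so the law can be solved for
  \<open>on_cell F \<phi>\<close>.\<close>

lemma whiskered_source:
  assumes f: "f \<in> hom C X Y"
  shows "L X \<star>\<^sub>2 id2 C (on_arr F f) \<in> cells C (on_arr F (l X \<star>\<^sub>1 f)) (A X \<star>\<^sub>1 on_arr F f)"
    "invertible_cell C (L X \<star>\<^sub>2 id2 C (on_arr F f))"
proof -
  have X: "X \<in> Obj C" using S.homD[OF f] by simp
  note Ff = arr[OF f]
  show "L X \<star>\<^sub>2 id2 C (on_arr F f) \<in> cells C (on_arr F (l X \<star>\<^sub>1 f)) (A X \<star>\<^sub>1 on_arr F f)"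
    using S.hcomp_cells_hom[OF L[OF X] S.id2_cells_hom[OF Ff] arr[OF l[OF X]] Ff]
    by (simp add: boundary(4)[OF f])
  show "invertible_cell C (L X \<star>\<^sub>2 id2 C (on_arr F f))"
    using S.invertible_hcomp[OF L[OF X] L_inv[OF X] S.id2_cells_hom[OF Ff]
        S.invertible_id2 arr[OF l[OF X]] Ff] S.homD[OF Ff] by simp
qed

lemma whiskered_target:
  assumes f: "f \<in> hom C X Y"
  shows "id2 C (on_arr F (on_arr F f)) \<star>\<^sub>2 L Y \<in> cells C (on_arr F (on_arr F f \<star>\<^sub>1 l Y)) (A X \<star>\<^sub>1 on_arr F f)"
    "invertible_cell C (id2 C (on_arr F (on_arr F f)) \<star>\<^sub>2 L Y)"
proof -
  have Y: "Y \<in> Obj C" using S.homD[OF f] by simp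
  note FFf = arr[OF arr[OF f]]
  show "id2 C (on_arr F (on_arr F f)) \<star>\<^sub>2 L Y \<in> cells C (on_arr F (on_arr F f \<star>\<^sub>1 l Y)) (A X \<star>\<^sub>1 on_arr F f)"
    \<comment> \<open>As computed, the whiskering ends at
      \<open>on_arr F (on_arr F f) \<star>\<^sub>1 A Y\<close>. Strict naturality of
      \<open>A\<close> identifies this with the required codomain.\<close>
    using S.hcomp_cells_hom[OF S.id2_cells_hom[OF FFf] L[OF Y] FFf arr[OF l[OF Y]]]
    by (simp add: boundary(3)[OF f] A_nat[OF f])
  show "invertible_cell C (id2 C (on_arr F (on_arr F f)) \<star>\<^sub>2 L Y)"
    using S.invertible_hcomp[OF S.id2_cells_hom[OF FFf] S.invertible_id2 L[OF Y] L_inv[OF Y]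
        FFf arr[OF l[OF Y]]] S.homD[OF FFf] by simp
qed

text \<open>The modification law localised at one arrow. The boundary of the 2-cell is included
  because faithfulness of \<open>F\<close> applies to parallel 2-cells; the naturality laws will be
  consequences of this condition.\<close>

definition coherent :: "'o \<Rightarrow> 'o \<Rightarrow> 'a \<Rightarrow> 'c \<Rightarrow> bool" where
  "coherent X Y f \<phi> \<longleftrightarrow> \<phi> \<in> cells C (on_arr F f \<star>\<^sub>1 l Y) (l X \<star>\<^sub>1 f) \<and>
     on_cell F \<phi> \<bullet> (L X \<star>\<^sub>2 id2 C (on_arr F f)) = id2 C (on_arr F (on_arr F f)) \<star>\<^sub>2 L Y"

text \<open>The whiskered \<open>L X\<close> is invertible, so cancelling it leaves the image under
  \<open>F\<close>, and \<open>F\<close> is faithful on 2-cells.\<close>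

lemma coherent_unique:
  assumes f: "f \<in> hom C X Y" and "coherent X Y f \<phi>" "coherent X Y f \<psi>"
  shows "\<phi> = \<psi>"
proof -
  have c: "\<phi> \<in> cells C (on_arr F f \<star>\<^sub>1 l Y) (l X \<star>\<^sub>1 f)" "\<psi> \<in> cells C (on_arr F f \<star>\<^sub>1 l Y) (l X \<star>\<^sub>1 f)"
    using assms unfolding coherent_def by auto
  have "on_cell F \<phi> = on_cell F \<psi>"
    by (rule S.vcomp_cancel_right[OF cell[OF c(1)] cell[OF c(2)] whiskered_source[OF f]])
      (use assms in \<open>simp add: coherent_def\<close>)
  with ff_faithful[OF ff c] show ?thesis .
qed

text \<open>Solving the law for \<open>on_cell F \<phi>\<close> gives an invertible 2-cell between
  images under \<open>F\<close>. Fullness lifts it, and invertibility is reflected.\<close>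

lemma coherent_exists:
  assumes f: "f \<in> hom C X Y"
  shows "\<exists>\<phi>. coherent X Y f \<phi> \<and> invertible_cell C \<phi>"
proof -
  note s = whiskered_source[OF f] and t = whiskered_target[OF f]
  obtain \<sigma> where \<sigma>: "\<sigma> \<in> cells C (A X \<star>\<^sub>1 on_arr F f) (on_arr F (l X \<star>\<^sub>1 f))"
    "\<sigma> \<bullet> (L X \<star>\<^sub>2 id2 C (on_arr F f)) = id2 C (A X \<star>\<^sub>1 on_arr F f)" "invertible_cell C \<sigma>"
    using S.invertible_cellE[OF s(2,1)] .
  let ?\<psi> = "(id2 C (on_arr F (on_arr F f)) \<star>\<^sub>2 L Y) \<bullet> \<sigma>"
  obtain \<phi> where \<phi>: "\<phi> \<in> cells C (on_arr F f \<star>\<^sub>1 l Y) (l X \<star>\<^sub>1 f)" "on_cell F \<phi> = ?\<psi>"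
    using ff_full[OF ff boundary(1,2)[OF f] S.vcomp_cells[OF t(1) \<sigma>(1)]] .
  have "?\<psi> \<bullet> (L X \<star>\<^sub>2 id2 C (on_arr F f)) = id2 C (on_arr F (on_arr F f)) \<star>\<^sub>2 L Y"
    using S.vcomp_assoc[OF t(1) \<sigma>(1) s(1)] \<sigma>(2) S.id2_right[OF t(1)] by simp
  moreover have "invertible_cell C \<phi>"
    using ff_reflects_invertible[OF ff \<phi>(1)] S.invertible_vcomp[OF t \<sigma>(1,3)] \<phi>(2) by simp
  ultimately show ?thesis
    using \<phi> unfolding coherent_def by auto
qed

text \<open>By \<open>coherent_unique\<close>, a unit or composition law for the chosen 2-cells
  holds as soon as the 2-cell it prescribes is coherent. For an identity arrow both whiskerings
  reduce to \<open>L X\<close>.\<close>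

lemma coherent_id1:
  assumes X: "X \<in> Obj C"
  shows "coherent X X (id1 C X) (id2 C (l X))"
proof -
  let ?FX = "on_obj F X"
  have FX: "?FX \<in> Obj C" "on_obj F ?FX \<in> Obj C" using X obj by auto
  have i: "on_arr F (id1 C X) = id1 C ?FX" "on_arr F (id1 C ?FX) = id1 C (on_obj F ?FX)"
    using X FX pres_id1 by auto
  have "on_cell F (id2 C (l X)) = id2 C (on_arr F (l X))"
    using pres_id2 S.homD[OF l[OF X]] by simp
  then have "on_cell F (id2 C (l X)) \<bullet> (L X \<star>\<^sub>2 id2 C (id1 C ?FX)) = id2 C (id1 C (on_obj F ?FX)) \<star>\<^sub>2 L X"
    using S.hcomp_left[OF L[OF X] arr[OF l[OF X]]] S.hcomp_right[OF L[OF X] arr[OF l[OF X]]]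
      S.id2_left[OF L[OF X]] by simp
  then show ?thesis
    unfolding coherent_def i
    using S.id1_left[OF l[OF X]] S.id1_right[OF l[OF X]] S.id2_cells_hom[OF l[OF X]] by simp
qed

text \<open>Two modification laws are pasted: that for \<open>f\<close> whiskered by
  \<open>on_arr F g\<close>, then that for \<open>g\<close> whiskered by
  \<open>on_arr F (on_arr F f)\<close>. The first produces the \<open>L Y\<close> that the second
  consumes.\<close>

lemma coherent_comp1:
  assumes f: "f \<in> hom C X Y" and g: "g \<in> hom C Y Z"
    and "coherent X Y f \<phi>" "coherent Y Z g \<psi>"
  shows "coherent X Z (f \<star>\<^sub>1 g) ((id2 C (on_arr F f) \<star>\<^sub>2 \<psi>) \<bullet> (\<phi> \<star>\<^sub>2 id2 C g))"
proof -
  have \<phi>: "\<phi> \<in> cells C (on_arr F f \<star>\<^sub>1 l Y) (l X \<star>\<^sub>1 f)"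
      "on_cell F \<phi> \<bullet> (L X \<star>\<^sub>2 id2 C (on_arr F f)) = id2 C (on_arr F (on_arr F f)) \<star>\<^sub>2 L Y"
    and \<psi>: "\<psi> \<in> cells C (on_arr F g \<star>\<^sub>1 l Z) (l Y \<star>\<^sub>1 g)"
      "on_cell F \<psi> \<bullet> (L Y \<star>\<^sub>2 id2 C (on_arr F g)) = id2 C (on_arr F (on_arr F g)) \<star>\<^sub>2 L Z"
    using assms unfolding coherent_def by auto
  have X: "X \<in> Obj C" "Y \<in> Obj C" "Z \<in> Obj C" using S.homD[OF f] S.homD[OF g] by auto
  note Ff = arr[OF f] and Fg = arr[OF g]
  note FFf = arr[OF Ff] and FFg = arr[OF Fg] and Fl = arr[OF l]
  have \<psi>': "id2 C (on_arr F f) \<star>\<^sub>2 \<psi> \<in> cells C (on_arr F f \<star>\<^sub>1 (on_arr F g \<star>\<^sub>1 l Z)) (on_arr F f \<star>\<^sub>1 (l Y \<star>\<^sub>1 g))"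
    by (rule S.hcomp_cells_hom[OF S.id2_cells_hom[OF Ff] \<psi>(1) Ff boundary(1)[OF g]])
  have \<phi>': "\<phi> \<star>\<^sub>2 id2 C g \<in> cells C (on_arr F f \<star>\<^sub>1 (l Y \<star>\<^sub>1 g)) (l X \<star>\<^sub>1 (f \<star>\<^sub>1 g))"
    using S.hcomp_cells_hom[OF \<phi>(1) S.id2_cells_hom[OF g] boundary(1)[OF f] g]
    by (simp add: S.comp1_assoc[OF Ff l g] S.comp1_assoc[OF l f g] X)
  have "(id2 C (on_arr F f) \<star>\<^sub>2 \<psi>) \<bullet> (\<phi> \<star>\<^sub>2 id2 C g) \<in> cells C (on_arr F (f \<star>\<^sub>1 g) \<star>\<^sub>1 l Z) (l X \<star>\<^sub>1 (f \<star>\<^sub>1 g))"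
    using S.vcomp_cells[OF \<psi>' \<phi>'] by (simp add: pres_comp1[OF f g] S.comp1_assoc[OF Ff Fg l] X)
  moreover have "on_cell F ((id2 C (on_arr F f) \<star>\<^sub>2 \<psi>) \<bullet> (\<phi> \<star>\<^sub>2 id2 C g)) \<bullet> (L X \<star>\<^sub>2 id2 C (on_arr F (f \<star>\<^sub>1 g)))
      = id2 C (on_arr F (on_arr F (f \<star>\<^sub>1 g))) \<star>\<^sub>2 L Z"
  proof -
    let ?Ff = "id2 C (on_arr F f)" and ?Fg = "id2 C (on_arr F g)"
    let ?FFf = "id2 C (on_arr F (on_arr F f))" and ?FFg = "id2 C (on_arr F (on_arr F g))"
    note iFf = S.id2_cells_hom[OF Ff] and iFg = S.id2_cells_hom[OF Fg]
    note iFFf = S.id2_cells_hom[OF FFf] and iFFg = S.id2_cells_hom[OF FFg]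
    have F1: "on_cell F (?Ff \<star>\<^sub>2 \<psi>) = ?FFf \<star>\<^sub>2 on_cell F \<psi>"
      using pres_hcomp[OF iFf \<psi>(1)] S.homD[OF Ff] S.homD[OF boundary(1)[OF g]]
      by (simp add: pres_id2)
    have F2: "on_cell F (\<phi> \<star>\<^sub>2 id2 C g) = on_cell F \<phi> \<star>\<^sub>2 ?Fg"
      using pres_hcomp[OF \<phi>(1) S.id2_cells_hom[OF g]] S.homD[OF g] S.homD[OF boundary(1)[OF f]]
      by (simp add: pres_id2)
    have F\<psi>: "on_cell F \<psi> \<in> cells C (on_arr F (on_arr F g) \<star>\<^sub>1 on_arr F (l Z)) (on_arr F (l Y) \<star>\<^sub>1 on_arr F g)"
      using cell[OF \<psi>(1)] boundary(3,4)[OF g] by simp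
    have F\<phi>: "on_cell F \<phi> \<in> cells C (on_arr F (on_arr F f) \<star>\<^sub>1 on_arr F (l Y)) (on_arr F (l X) \<star>\<^sub>1 on_arr F f)"
      using cell[OF \<phi>(1)] boundary(3,4)[OF f] by simp
    have LFf: "L X \<star>\<^sub>2 ?Ff \<in> cells C (on_arr F (l X) \<star>\<^sub>1 on_arr F f) (A X \<star>\<^sub>1 on_arr F f)"
      using whiskered_source(1)[OF f] boundary(4)[OF f] by simp
    have LFg: "L Y \<star>\<^sub>2 ?Fg \<in> cells C (on_arr F (l Y) \<star>\<^sub>1 on_arr F g) (A Y \<star>\<^sub>1 on_arr F g)"
      using whiskered_source(1)[OF g] boundary(4)[OF g] by simp
    have hFFf_lY: "on_arr F (on_arr F f) \<star>\<^sub>1 on_arr F (l Y) \<in> hom C (on_obj F (on_obj F X)) (on_obj F Y)"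
      using S.comp1_hom[OF FFf Fl[OF X(2)]] .
    have hFFg_lZ: "on_arr F (on_arr F g) \<star>\<^sub>1 on_arr F (l Z) \<in> hom C (on_obj F (on_obj F Y)) (on_obj F Z)"
      using S.comp1_hom[OF FFg Fl[OF X(3)]] .
    have c1: "?FFf \<star>\<^sub>2 on_cell F \<psi> \<in> cells C (on_arr F (on_arr F f) \<star>\<^sub>1 (on_arr F (on_arr F g) \<star>\<^sub>1 on_arr F (l Z)))
        (on_arr F (on_arr F f) \<star>\<^sub>1 (on_arr F (l Y) \<star>\<^sub>1 on_arr F g))"
      by (rule S.hcomp_cells_hom[OF iFFf F\<psi> FFf hFFg_lZ])
    have c2: "on_cell F \<phi> \<star>\<^sub>2 ?Fg \<in> cells C (on_arr F (on_arr F f) \<star>\<^sub>1 (on_arr F (l Y) \<star>\<^sub>1 on_arr F g))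
        ((on_arr F (l X) \<star>\<^sub>1 on_arr F f) \<star>\<^sub>1 on_arr F g)"
      using S.hcomp_cells_hom[OF F\<phi> iFg hFFf_lY Fg] S.comp1_assoc[OF FFf Fl[OF X(2)] Fg] by simp
    have c3: "(L X \<star>\<^sub>2 ?Ff) \<star>\<^sub>2 ?Fg \<in> cells C ((on_arr F (l X) \<star>\<^sub>1 on_arr F f) \<star>\<^sub>1 on_arr F g)
        ((A X \<star>\<^sub>1 on_arr F f) \<star>\<^sub>1 on_arr F g)"
      by (rule S.hcomp_cells_hom[OF LFf iFg S.comp1_hom[OF Fl[OF X(1)] Ff] Fg])
    \<comment> \<open>Whiskering by the image of a composite is whiskering twice, which exposes the
      part of \<open>L X\<close> that occurs in the law for \<open>f\<close>.\<close>
    have "L X \<star>\<^sub>2 id2 C (on_arr F (f \<star>\<^sub>1 g)) = (L X \<star>\<^sub>2 ?Ff) \<star>\<^sub>2 ?Fg"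
      using S.hcomp_assoc_hom[OF L[OF X(1)] iFf iFg Fl[OF X(1)] Ff Fg] S.hcomp_id2[OF Ff Fg]
        pres_comp1[OF f g] by simp
    then have "on_cell F ((?Ff \<star>\<^sub>2 \<psi>) \<bullet> (\<phi> \<star>\<^sub>2 id2 C g)) \<bullet> (L X \<star>\<^sub>2 id2 C (on_arr F (f \<star>\<^sub>1 g)))
        = (?FFf \<star>\<^sub>2 on_cell F \<psi>) \<bullet> ((on_cell F \<phi> \<star>\<^sub>2 ?Fg) \<bullet> ((L X \<star>\<^sub>2 ?Ff) \<star>\<^sub>2 ?Fg))"
      using S.vcomp_assoc[OF c1 c2 c3] pres_vcomp[OF \<psi>' \<phi>'] F1 F2 by simp
    \<comment> \<open>The law for \<open>f\<close>, whiskered on the right by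
      \<open>on_arr F g\<close>.\<close>
    also have "(on_cell F \<phi> \<star>\<^sub>2 ?Fg) \<bullet> ((L X \<star>\<^sub>2 ?Ff) \<star>\<^sub>2 ?Fg) = (?FFf \<star>\<^sub>2 L Y) \<star>\<^sub>2 ?Fg"
      using S.whisker_right_vcomp[OF Fg hFFf_lY F\<phi> LFf] \<phi>(2) by simp
    also have "\<dots> = ?FFf \<star>\<^sub>2 (L Y \<star>\<^sub>2 ?Fg)"
      by (rule S.hcomp_assoc_hom[OF iFFf L[OF X(2)] iFg FFf Fl[OF X(2)] Fg])
    \<comment> \<open>The law for \<open>g\<close>, whiskered on the left. It applies because
      reassociation has grouped \<open>L Y\<close> with \<open>?Fg\<close>.\<close>
    also have "(?FFf \<star>\<^sub>2 on_cell F \<psi>) \<bullet> \<dots> = ?FFf \<star>\<^sub>2 (?FFg \<star>\<^sub>2 L Z)"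
      using S.whisker_left_vcomp[OF FFf hFFg_lZ F\<psi> LFg] \<psi>(2) by simp
    also have "\<dots> = (?FFf \<star>\<^sub>2 ?FFg) \<star>\<^sub>2 L Z"
      by (rule S.hcomp_assoc_hom[OF iFFf iFFg L[OF X(3)] FFf FFg Fl[OF X(3)], symmetric])
    also have "?FFf \<star>\<^sub>2 ?FFg = id2 C (on_arr F (on_arr F (f \<star>\<^sub>1 g)))"
      using S.hcomp_id2[OF FFf FFg] pres_comp1[OF f g] pres_comp1[OF Ff Fg] by simp
    finally show ?thesis .
  qed
  ultimately show ?thesis unfolding coherent_def by blast
qed

text \<open>Both sides run from \<open>on_arr F f \<star>\<^sub>1 l Y\<close> to
  \<open>l X \<star>\<^sub>1 g\<close>, a boundary mixing \<open>f\<close> and \<open>g\<close> that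
  \<open>coherent\<close> does not cover. They are therefore compared directly, after applying
  \<open>F\<close> and composing with \<open>L X\<close> whiskered by
  \<open>on_arr F g\<close>.\<close>

lemma coherent_natural:
  assumes f: "f \<in> hom C X Y" and \<theta>: "\<theta> \<in> cells C f g"
    and "coherent X Y f \<phi>" "coherent X Y g \<psi>"
  shows "(on_cell F \<theta> \<star>\<^sub>2 id2 C (l Y)) \<bullet> \<psi> = \<phi> \<bullet> (id2 C (l X) \<star>\<^sub>2 \<theta>)"
proof -
  have \<phi>: "\<phi> \<in> cells C (on_arr F f \<star>\<^sub>1 l Y) (l X \<star>\<^sub>1 f)"
      "on_cell F \<phi> \<bullet> (L X \<star>\<^sub>2 id2 C (on_arr F f)) = id2 C (on_arr F (on_arr F f)) \<star>\<^sub>2 L Y"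
    and \<psi>: "\<psi> \<in> cells C (on_arr F g \<star>\<^sub>1 l Y) (l X \<star>\<^sub>1 g)"
      "on_cell F \<psi> \<bullet> (L X \<star>\<^sub>2 id2 C (on_arr F g)) = id2 C (on_arr F (on_arr F g)) \<star>\<^sub>2 L Y"
    using assms unfolding coherent_def by auto
  have X: "X \<in> Obj C" "Y \<in> Obj C" using S.homD[OF f] by auto
  have g: "g \<in> hom C X Y" using S.cells_hom(1)[OF \<theta> f] .
  note lX = l[OF X(1)] and lY = l[OF X(2)]
  note ilX = S.id2_cells_hom[OF lX] and ilY = S.id2_cells_hom[OF lY]
  note Ff = arr[OF f] and Fg = arr[OF g] and F\<theta> = cell[OF \<theta>]
  note FFf = arr[OF Ff] and FFg = arr[OF Fg] and FF\<theta> = cell[OF F\<theta>]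
  note FlX = arr[OF lX] and FlY = arr[OF lY]
  note AX = A[OF X(1)]
  note sf = whiskered_source(1)[OF f] and sg = whiskered_source[OF g]
  have a: "on_cell F \<theta> \<star>\<^sub>2 id2 C (l Y) \<in> cells C (on_arr F f \<star>\<^sub>1 l Y) (on_arr F g \<star>\<^sub>1 l Y)"
    by (rule S.hcomp_cells_hom[OF F\<theta> ilY Ff lY])
  have b: "id2 C (l X) \<star>\<^sub>2 \<theta> \<in> cells C (l X \<star>\<^sub>1 f) (l X \<star>\<^sub>1 g)"
    by (rule S.hcomp_cells_hom[OF ilX \<theta> lX f])
  have Fa: "on_cell F (on_cell F \<theta> \<star>\<^sub>2 id2 C (l Y)) = on_cell F (on_cell F \<theta>) \<star>\<^sub>2 id2 C (on_arr F (l Y))"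
    using pres_hcomp[OF F\<theta> ilY] S.homD[OF Ff] S.homD[OF lY] by (simp add: pres_id2)
  have Fb: "on_cell F (id2 C (l X) \<star>\<^sub>2 \<theta>) = id2 C (on_arr F (l X)) \<star>\<^sub>2 on_cell F \<theta>"
    using pres_hcomp[OF ilX \<theta>] S.homD[OF f] S.homD[OF lX] by (simp add: pres_id2)
  have AX\<theta>: "id2 C (A X) \<star>\<^sub>2 on_cell F \<theta> \<in> cells C (A X \<star>\<^sub>1 on_arr F f) (A X \<star>\<^sub>1 on_arr F g)"
    by (rule S.hcomp_cells_hom[OF S.id2_cells_hom[OF AX] F\<theta> AX Ff])
  let ?s = "L X \<star>\<^sub>2 id2 C (on_arr F g)"
  \<comment> \<open>The law for \<open>g\<close> eliminates \<psi>.\<close>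
  have "on_cell F ((on_cell F \<theta> \<star>\<^sub>2 id2 C (l Y)) \<bullet> \<psi>) \<bullet> ?s =
      (on_cell F (on_cell F \<theta>) \<star>\<^sub>2 id2 C (on_arr F (l Y))) \<bullet> (id2 C (on_arr F (on_arr F g)) \<star>\<^sub>2 L Y)"
    using S.vcomp_assoc[OF cell[OF a] cell[OF \<psi>(1)] sg(1)] pres_vcomp[OF a \<psi>(1)] Fa \<psi>(2) by simp
  also have "\<dots> = on_cell F (on_cell F \<theta>) \<star>\<^sub>2 L Y"
    by (rule S.hcomp_left_then_right[OF FF\<theta> L[OF X(2)] FFf FlY])
  \<comment> \<open>The horizontal composite is split in the other order, so that the image of
    \<theta> stands after \<open>L Y\<close>, whiskered by \<open>A Y\<close>.\<close>
  also have "\<dots> = (id2 C (on_arr F (on_arr F f)) \<star>\<^sub>2 L Y) \<bullet> (on_cell F (on_cell F \<theta>) \<star>\<^sub>2 id2 C (A Y))"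
    by (rule S.hcomp_right_then_left[OF FF\<theta> L[OF X(2)] FFf FlY, symmetric])
  \<comment> \<open>\<open>A_nat_cell\<close> trades the whiskering by \<open>A Y\<close> for one by
    \<open>A X\<close>, and the law for \<open>f\<close>, read backwards, brings in \<phi>.\<close>
  also have "\<dots> = (on_cell F \<phi> \<bullet> (L X \<star>\<^sub>2 id2 C (on_arr F f))) \<bullet> (id2 C (A X) \<star>\<^sub>2 on_cell F \<theta>)"
    using A_nat_cell[OF f \<theta>] \<phi>(2) by simp
  also have "\<dots> = on_cell F \<phi> \<bullet> ((L X \<star>\<^sub>2 id2 C (on_arr F f)) \<bullet> (id2 C (A X) \<star>\<^sub>2 on_cell F \<theta>))"
    by (rule S.vcomp_assoc[OF cell[OF \<phi>(1)] sf AX\<theta>])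
  \<comment> \<open>Sliding the image of \<theta> past \<open>L X\<close> leaves \<open>?s\<close>
    as the last factor, ready to be cancelled.\<close>
  also have "(L X \<star>\<^sub>2 id2 C (on_arr F f)) \<bullet> (id2 C (A X) \<star>\<^sub>2 on_cell F \<theta>) =
      (id2 C (on_arr F (l X)) \<star>\<^sub>2 on_cell F \<theta>) \<bullet> ?s"
    using S.hcomp_left_then_right[OF L[OF X(1)] F\<theta> FlX Ff]
      S.hcomp_right_then_left[OF L[OF X(1)] F\<theta> FlX Ff] by simp
  also have "on_cell F \<phi> \<bullet> \<dots> = on_cell F (\<phi> \<bullet> (id2 C (l X) \<star>\<^sub>2 \<theta>)) \<bullet> ?s"
    using S.vcomp_assoc[OF cell[OF \<phi>(1)] cell[OF b] sg(1)] pres_vcomp[OF \<phi>(1) b] Fb by simp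
  finally have "on_cell F ((on_cell F \<theta> \<star>\<^sub>2 id2 C (l Y)) \<bullet> \<psi>) = on_cell F (\<phi> \<bullet> (id2 C (l X) \<star>\<^sub>2 \<theta>))"
    by (rule S.vcomp_cancel_right[OF cell[OF S.vcomp_cells[OF a \<psi>(1)]]
          cell[OF S.vcomp_cells[OF \<phi>(1) b]] sg])
  then show ?thesis
    by (rule ff_faithful[OF ff S.vcomp_cells[OF a \<psi>(1)] S.vcomp_cells[OF \<phi>(1) b]])
qed

text \<open>A HOL function also takes values off \<open>Arr C\<close>. Membership in
  \<open>extensional (Arr C)\<close> fixes those values, so that uniqueness is a claim about arrows
  of \<open>C\<close> only.\<close>

theorem pseudonatural_lift_unique:
  "\<exists>!t. t \<in> extensional (Arr C) \<and> pseudonatural C C F id_2functor l t \<and>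
     (\<forall>X\<in>Obj C. \<forall>Y\<in>Obj C. \<forall>f\<in>hom C X Y.
        on_cell F (t f) \<bullet> (L X \<star>\<^sub>2 id2 C (on_arr F f)) = id2 C (on_arr F (on_arr F f)) \<star>\<^sub>2 L Y)"
proof -
  let ?mod = "\<lambda>t. \<forall>X\<in>Obj C. \<forall>Y\<in>Obj C. \<forall>f\<in>hom C X Y.
        on_cell F (t f) \<bullet> (L X \<star>\<^sub>2 id2 C (on_arr F f)) = id2 C (on_arr F (on_arr F f)) \<star>\<^sub>2 L Y"
  \<comment> \<open>The source and target of each arrow recover its endpoints. By
    \<open>coherent_unique\<close> the choice operator has exactly one candidate on every
    arrow.\<close>
  define t where "t = restrict (\<lambda>f. SOME \<phi>. coherent (src C f) (tgt C f) f \<phi> \<and> invertible_cell C \<phi>) (Arr C)"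
  have t: "coherent X Y f (t f) \<and> invertible_cell C (t f)" if f: "f \<in> hom C X Y" for f X Y
    using someI_ex[OF coherent_exists[OF f]] S.homD[OF f] by (simp add: t_def)
  have t_eq: "t f = \<phi>" if "f \<in> hom C X Y" "coherent X Y f \<phi>" for f X Y \<phi>
    using coherent_unique that t by blast
  have pn_t: "pseudonatural C C F id_2functor l t"
    unfolding pseudonatural_def
  proof (intro conjI ballI)
    fix X assume X: "X \<in> Obj C"
    show "l X \<in> hom C (on_obj F X) (on_obj id_2functor X)"
      using l[OF X] by (simp add: id_2functor_def)
    show "t (id1 C X) = id2 C (l X)"
      using t_eq[OF S.id1_hom[OF X] coherent_id1[OF X]] .
  next
    fix X Y f assume f: "f \<in> hom C X Y"
    show "t f \<in> cells C (on_arr F f \<star>\<^sub>1 l Y) (l X \<star>\<^sub>1 on_arr id_2functor f)"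
      using t[OF f] by (simp add: id_2functor_def coherent_def)
    show "invertible_cell C (t f)" using t[OF f] by simp
  next
    fix X Y Z f g assume f: "f \<in> hom C X Y" and g: "g \<in> hom C Y Z"
    show "t (f \<star>\<^sub>1 g) = (id2 C (on_arr F f) \<star>\<^sub>2 t g) \<bullet> (t f \<star>\<^sub>2 id2 C (on_arr id_2functor g))"
      using t_eq[OF S.comp1_hom[OF f g] coherent_comp1[OF f g]] t[OF f] t[OF g]
      by (simp add: id_2functor_def)
  next
    fix X Y f g \<theta> assume f: "f \<in> hom C X Y" and g: "g \<in> hom C X Y" and \<theta>: "\<theta> \<in> cells C f g"
    show "(on_cell F \<theta> \<star>\<^sub>2 id2 C (l Y)) \<bullet> t g = t f \<bullet> (id2 C (l X) \<star>\<^sub>2 on_cell id_2functor \<theta>)"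
      using coherent_natural[OF f \<theta>] t[OF f] t[OF g] by (simp add: id_2functor_def)
  qed
  have mod_t: "?mod t"
    using t by (simp add: coherent_def)
  have ext_t: "t \<in> extensional (Arr C)" by (simp add: t_def)
  have uniq: "t' = t"
    if ext: "t' \<in> extensional (Arr C)" and pn: "pseudonatural C C F id_2functor l t'" and m: "?mod t'" for t'
  proof (rule extensionalityI[OF ext ext_t])
    fix f assume "f \<in> Arr C"
    then have f: "f \<in> hom C (src C f) (tgt C f)" by (simp add: hom_def)
    then have X: "src C f \<in> Obj C" "tgt C f \<in> Obj C" using S.homD[OF f] by auto
    \<comment> \<open>Pseudonaturality of \<open>t'\<close> supplies the boundary of
      \<open>t' f\<close>, and \<open>?mod t'\<close> supplies the equation.\<close>
    have "coherent (src C f) (tgt C f) f (t' f)"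
      using pn m f X unfolding coherent_def pseudonatural_def id_2functor_def by simp
    then show "t' f = t f" using t_eq[OF f] by simp
  qed
  show ?thesis
    by (rule ex1I[of _ t], intro conjI ext_t pn_t mod_t, elim conjE, rule uniq)
qed

end

section \<open>Tensoring with an object\<close>

context semi_monoidal_2category
begin

text \<open>The 2-functor \<open>tensor C\<close> lives on \<open>prod_2cat C C\<close>. From here
  to \<open>tensor_hcomp\<close> its laws on pairs are put in componentwise form.\<close>

lemma tensor_hom:
  "\<lbrakk>f \<in> hom C X Y; g \<in> hom C X' Y'\<rbrakk> \<Longrightarrow> f \<otimes>\<^sub>1 g \<in> hom C (X \<otimes>\<^sub>0 X') (Y \<otimes>\<^sub>0 Y')"
  using arr[of "(f, g)" "(X, X')" "(Y, Y')"] by (auto simp: hom_def prod_2cat_def)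

lemma tensor_obj: "\<lbrakk>X \<in> Obj C; Y \<in> Obj C\<rbrakk> \<Longrightarrow> X \<otimes>\<^sub>0 Y \<in> Obj C"
  using obj[of "(X, Y)"] by (simp add: prod_2cat_def)

lemma tensor_cells:
  "\<lbrakk>\<phi> \<in> cells C f g; \<psi> \<in> cells C f' g'\<rbrakk> \<Longrightarrow> \<phi> \<otimes>\<^sub>2 \<psi> \<in> cells C (f \<otimes>\<^sub>1 f') (g \<otimes>\<^sub>1 g')"
  using cell[of "(\<phi>, \<psi>)" "(f, f')" "(g, g')"] by (auto simp: cells_def prod_2cat_def)

lemma tensor_id1: "\<lbrakk>X \<in> Obj C; Y \<in> Obj C\<rbrakk> \<Longrightarrow> id1 C X \<otimes>\<^sub>1 id1 C Y = id1 C (X \<otimes>\<^sub>0 Y)"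
  using pres_id1[of "(X, Y)"] by (simp add: prod_2cat_def)

lemma tensor_id2: "\<lbrakk>f \<in> Arr C; g \<in> Arr C\<rbrakk> \<Longrightarrow> id2 C f \<otimes>\<^sub>2 id2 C g = id2 C (f \<otimes>\<^sub>1 g)"
  using pres_id2[of "(f, g)"] by (simp add: prod_2cat_def)

lemma tensor_comp1:
  "\<lbrakk>f \<in> hom C X Y; g \<in> hom C Y Z; f' \<in> hom C X' Y'; g' \<in> hom C Y' Z'\<rbrakk> \<Longrightarrow>
    (f \<star>\<^sub>1 g) \<otimes>\<^sub>1 (f' \<star>\<^sub>1 g') = (f \<otimes>\<^sub>1 f') \<star>\<^sub>1 (g \<otimes>\<^sub>1 g')"
  using pres_comp1[of "(f, f')" "(X, X')" "(Y, Y')" "(g, g')" "(Z, Z')"]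
  by (simp add: hom_def prod_2cat_def)

lemma tensor_vcomp:
  "\<lbrakk>\<phi> \<in> cells C f g; \<psi> \<in> cells C g h; \<phi>' \<in> cells C f' g'; \<psi>' \<in> cells C g' h'\<rbrakk> \<Longrightarrow>
    (\<phi> \<bullet> \<psi>) \<otimes>\<^sub>2 (\<phi>' \<bullet> \<psi>') = (\<phi> \<otimes>\<^sub>2 \<phi>') \<bullet> (\<psi> \<otimes>\<^sub>2 \<psi>')"
  using pres_vcomp[of "(\<phi>, \<phi>')" "(f, f')" "(g, g')" "(\<psi>, \<psi>')" "(h, h')"]
  by (simp add: cells_def prod_2cat_def)

lemma tensor_hcomp:
  "\<lbrakk>\<phi> \<in> cells C f g; \<psi> \<in> cells C h k; tgt C f = src C h;
    \<phi>' \<in> cells C f' g'; \<psi>' \<in> cells C h' k'; tgt C f' = src C h'\<rbrakk> \<Longrightarrow>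
    (\<phi> \<star>\<^sub>2 \<psi>) \<otimes>\<^sub>2 (\<phi>' \<star>\<^sub>2 \<psi>') = (\<phi> \<otimes>\<^sub>2 \<phi>') \<star>\<^sub>2 (\<psi> \<otimes>\<^sub>2 \<psi>')"
  using pres_hcomp[of "(\<phi>, \<phi>')" "(f, f')" "(g, g')" "(\<psi>, \<psi>')" "(h, h')" "(k, k')"]
  by (simp add: cells_def prod_2cat_def)

lemma id2_id1_cells: "X \<in> Obj C \<Longrightarrow> id2 C (id1 C X) \<in> cells C (id1 C X) (id1 C X)"
  using id2_cells_hom id1_hom by blast

text \<open>Fixing the identity of \<open>I\<close> in one slot is functorial because identities are
  idempotent for all three compositions.\<close>

lemma left_tensor_2functor:
  assumes I: "I \<in> Obj C"
  shows "strict_2functor C C (left_tensor C I)"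
proof (intro strict_2functor.intro strict_2functor_axioms.intro strict_2category_axioms)
  note i = id1_hom[OF I] and ii = id2_id1_cells[OF I]
  have ia: "id1 C I \<in> Arr C" "src C (id1 C I) = I" "tgt C (id1 C I) = I" using homD[OF i] by auto
  show "on_obj (left_tensor C I) X \<in> Obj C" if "X \<in> Obj C" for X
    using that tensor_obj I by (simp add: left_tensor_def)
  show "on_arr (left_tensor C I) f \<in> hom C (on_obj (left_tensor C I) X) (on_obj (left_tensor C I) Y)"
    if "f \<in> hom C X Y" for f X Y
    using tensor_hom[OF i that] by (simp add: left_tensor_def)
  show "on_cell (left_tensor C I) \<phi> \<in> cells C (on_arr (left_tensor C I) f) (on_arr (left_tensor C I) g)"
    if "\<phi> \<in> cells C f g" for \<phi> f g
    using tensor_cells[OF ii that] by (simp add: left_tensor_def)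
  show "on_arr (left_tensor C I) (id1 C X) = id1 C (on_obj (left_tensor C I) X)" if "X \<in> Obj C" for X
    using tensor_id1[OF I that] by (simp add: left_tensor_def)
  show "on_arr (left_tensor C I) (f \<star>\<^sub>1 g) = on_arr (left_tensor C I) f \<star>\<^sub>1 on_arr (left_tensor C I) g"
    if "f \<in> hom C X Y" "g \<in> hom C Y Z" for f g X Y Z
    using tensor_comp1[OF i i that] id1_left[OF i] by (simp add: left_tensor_def)
  show "on_cell (left_tensor C I) (id2 C f) = id2 C (on_arr (left_tensor C I) f)" if "f \<in> Arr C" for f
    using tensor_id2[OF ia(1) that] by (simp add: left_tensor_def)
  show "on_cell (left_tensor C I) (\<phi> \<bullet> \<psi>) = on_cell (left_tensor C I) \<phi> \<bullet> on_cell (left_tensor C I) \<psi>"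
    if "\<phi> \<in> cells C f g" "\<psi> \<in> cells C g h" for \<phi> \<psi> f g h
    using tensor_vcomp[OF ii ii that] id2_left[OF ii] by (simp add: left_tensor_def)
  show "on_cell (left_tensor C I) (\<phi> \<star>\<^sub>2 \<psi>) = on_cell (left_tensor C I) \<phi> \<star>\<^sub>2 on_cell (left_tensor C I) \<psi>"
    if "\<phi> \<in> cells C f f'" "\<psi> \<in> cells C g g'" "tgt C f = src C g" for \<phi> \<psi> f f' g g'
    using tensor_hcomp[OF ii ii _ that] hcomp_left[OF ii i] ia by (simp add: left_tensor_def)
qed

lemma right_tensor_2functor:
  assumes I: "I \<in> Obj C"
  shows "strict_2functor C C (right_tensor C I)"
proof (intro strict_2functor.intro strict_2functor_axioms.intro strict_2category_axioms)
  note i = id1_hom[OF I] and ii = id2_id1_cells[OF I]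
  have ia: "id1 C I \<in> Arr C" "src C (id1 C I) = I" "tgt C (id1 C I) = I" using homD[OF i] by auto
  show "on_obj (right_tensor C I) X \<in> Obj C" if "X \<in> Obj C" for X
    using that tensor_obj I by (simp add: right_tensor_def)
  show "on_arr (right_tensor C I) f \<in> hom C (on_obj (right_tensor C I) X) (on_obj (right_tensor C I) Y)"
    if "f \<in> hom C X Y" for f X Y
    using tensor_hom[OF that i] by (simp add: right_tensor_def)
  show "on_cell (right_tensor C I) \<phi> \<in> cells C (on_arr (right_tensor C I) f) (on_arr (right_tensor C I) g)"
    if "\<phi> \<in> cells C f g" for \<phi> f g
    using tensor_cells[OF that ii] by (simp add: right_tensor_def)
  show "on_arr (right_tensor C I) (id1 C X) = id1 C (on_obj (right_tensor C I) X)" if "X \<in> Obj C" for X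
    using tensor_id1[OF that I] by (simp add: right_tensor_def)
  show "on_arr (right_tensor C I) (f \<star>\<^sub>1 g) = on_arr (right_tensor C I) f \<star>\<^sub>1 on_arr (right_tensor C I) g"
    if "f \<in> hom C X Y" "g \<in> hom C Y Z" for f g X Y Z
    using tensor_comp1[OF that i i] id1_left[OF i] by (simp add: right_tensor_def)
  show "on_cell (right_tensor C I) (id2 C f) = id2 C (on_arr (right_tensor C I) f)" if "f \<in> Arr C" for f
    using tensor_id2[OF that ia(1)] by (simp add: right_tensor_def)
  show "on_cell (right_tensor C I) (\<phi> \<bullet> \<psi>) = on_cell (right_tensor C I) \<phi> \<bullet> on_cell (right_tensor C I) \<psi>"
    if "\<phi> \<in> cells C f g" "\<psi> \<in> cells C g h" for \<phi> \<psi> f g h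
    using tensor_vcomp[OF that ii ii] id2_left[OF ii] by (simp add: right_tensor_def)
  show "on_cell (right_tensor C I) (\<phi> \<star>\<^sub>2 \<psi>) = on_cell (right_tensor C I) \<phi> \<star>\<^sub>2 on_cell (right_tensor C I) \<psi>"
    if "\<phi> \<in> cells C f f'" "\<psi> \<in> cells C g g'" "tgt C f = src C g" for \<phi> \<psi> f f' g g'
    using tensor_hcomp[OF that ii ii] hcomp_left[OF ii i] ia by (simp add: right_tensor_def)
qed

text \<open>This is functoriality of the tensor product with identities inserted. Taking \<alpha>
  for one of the two arrows yields strict naturality of the transformation \<alpha> X or X
  \<alpha>.\<close>

lemma tensor_arr_factor:
  assumes a: "a \<in> hom C X Y" and f: "f \<in> hom C X' Y'"
  shows "(id1 C X \<otimes>\<^sub>1 f) \<star>\<^sub>1 (a \<otimes>\<^sub>1 id1 C Y') = a \<otimes>\<^sub>1 f"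
    "(a \<otimes>\<^sub>1 id1 C X') \<star>\<^sub>1 (id1 C Y \<otimes>\<^sub>1 f) = a \<otimes>\<^sub>1 f"
proof -
  have o: "X \<in> Obj C" "Y \<in> Obj C" "X' \<in> Obj C" "Y' \<in> Obj C" using homD[OF a] homD[OF f] by auto
  show "(id1 C X \<otimes>\<^sub>1 f) \<star>\<^sub>1 (a \<otimes>\<^sub>1 id1 C Y') = a \<otimes>\<^sub>1 f"
    using tensor_comp1[OF id1_hom[OF o(1)] a f id1_hom[OF o(4)]] id1_left[OF a] id1_right[OF f] by simp
  show "(a \<otimes>\<^sub>1 id1 C X') \<star>\<^sub>1 (id1 C Y \<otimes>\<^sub>1 f) = a \<otimes>\<^sub>1 f"
    using tensor_comp1[OF a id1_hom[OF o(2)] id1_hom[OF o(3)] f] id1_left[OF f] id1_right[OF a] by simp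
qed

lemma tensor_cell_factor:
  assumes a: "\<psi> \<in> cells C a b" "a \<in> hom C X Y" and f: "\<phi> \<in> cells C f g" "f \<in> hom C X' Y'"
  shows "(id2 C (id1 C X) \<otimes>\<^sub>2 \<phi>) \<star>\<^sub>2 (\<psi> \<otimes>\<^sub>2 id2 C (id1 C Y')) = \<psi> \<otimes>\<^sub>2 \<phi>"
    "(\<psi> \<otimes>\<^sub>2 id2 C (id1 C X')) \<star>\<^sub>2 (id2 C (id1 C Y) \<otimes>\<^sub>2 \<phi>) = \<psi> \<otimes>\<^sub>2 \<phi>"
proof -
  have o: "X \<in> Obj C" "Y \<in> Obj C" "X' \<in> Obj C" "Y' \<in> Obj C"
    and s: "src C a = X" "tgt C a = Y" "src C f = X'" "tgt C f = Y'"
    using homD[OF a(2)] homD[OF f(2)] by auto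
  have i: "src C (id1 C Z) = Z" "tgt C (id1 C Z) = Z" if "Z \<in> Obj C" for Z
    using homD[OF id1_hom[OF that]] by auto
  show "(id2 C (id1 C X) \<otimes>\<^sub>2 \<phi>) \<star>\<^sub>2 (\<psi> \<otimes>\<^sub>2 id2 C (id1 C Y')) = \<psi> \<otimes>\<^sub>2 \<phi>"
    using tensor_hcomp[OF id2_id1_cells[OF o(1)] a(1) _ f(1) id2_id1_cells[OF o(4)]]
      hcomp_left[OF a] hcomp_right[OF f] o s i by simp
  show "(\<psi> \<otimes>\<^sub>2 id2 C (id1 C X')) \<star>\<^sub>2 (id2 C (id1 C Y) \<otimes>\<^sub>2 \<phi>) = \<psi> \<otimes>\<^sub>2 \<phi>"
    using tensor_hcomp[OF a(1) id2_id1_cells[OF o(2)] _ id2_id1_cells[OF o(3)] f(1)]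
      hcomp_left[OF f] hcomp_right[OF a] o s i by simp
qed

section \<open>The two unit constraints of a fixed unit object\<close>

context
  fixes I \<alpha>
  assumes unit: "unit_object C I \<alpha>"
begin

lemma unitD:
  "I \<in> Obj C" "\<alpha> \<in> hom C (I \<otimes>\<^sub>0 I) I" "equi_arrow C \<alpha>" "id2 C \<alpha> \<in> cells C \<alpha> \<alpha>"
  "fully_faithful_2functor C C (left_tensor C I)" "fully_faithful_2functor C C (right_tensor C I)"
  using unit id2_cells_hom unfolding unit_object_def cancellable_def by blast+

text \<open>Strict associativity turns I(I f) into (I I) f, and the identity of I I is the tensor of
  two identities of I. The factorisation lemmas with \<alpha> in the first slot then close the
  naturality squares.\<close>

lemma left_endo: "fully_faithful_endo C (left_tensor C I) (\<lambda>X. \<alpha> \<otimes>\<^sub>1 id1 C X)"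
proof (intro fully_faithful_endo.intro fully_faithful_endo_axioms.intro left_tensor_2functor unitD)
  note I = unitD(1) and a = unitD(2)
  note i = id1_hom[OF I] and ii = id2_id1_cells[OF I]
  have ia: "id1 C I \<in> Arr C" "id2 C (id1 C I) \<in> Cell C" and aa: "\<alpha> \<in> Arr C"
    using homD[OF i] cellsD[OF ii] homD[OF a] by auto
  show "\<alpha> \<otimes>\<^sub>1 id1 C X \<in> hom C (on_obj (left_tensor C I) (on_obj (left_tensor C I) X)) (on_obj (left_tensor C I) X)"
    if X: "X \<in> Obj C" for X
    using tensor_hom[OF a id1_hom[OF X]] tensor_obj_assoc[OF I I X] by (simp add: left_tensor_def)
  show "on_arr (left_tensor C I) (on_arr (left_tensor C I) f) \<star>\<^sub>1 (\<alpha> \<otimes>\<^sub>1 id1 C Y) =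
      (\<alpha> \<otimes>\<^sub>1 id1 C X) \<star>\<^sub>1 on_arr (left_tensor C I) f" if f: "f \<in> hom C X Y" for f X Y
    using tensor_arr_factor[OF a f] tensor_arr_assoc[OF ia(1) ia(1), of f] tensor_id1[OF I I] homD[OF f]
    by (simp add: left_tensor_def)
  show "on_cell (left_tensor C I) (on_cell (left_tensor C I) \<phi>) \<star>\<^sub>2 id2 C (\<alpha> \<otimes>\<^sub>1 id1 C Y) =
      id2 C (\<alpha> \<otimes>\<^sub>1 id1 C X) \<star>\<^sub>2 on_cell (left_tensor C I) \<phi>"
    if f: "f \<in> hom C X Y" and \<phi>: "\<phi> \<in> cells C f g" for f X Y \<phi> g
  proof -
    have o: "id1 C X \<in> Arr C" "id1 C Y \<in> Arr C" using homD[OF f] id1_hom homD by blast+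
    show ?thesis
      using tensor_cell_factor[OF unitD(4) a \<phi> f] tensor_cell_assoc[OF ia(2) ia(2), of \<phi>]
        tensor_id2[OF ia(1) ia(1)] tensor_id1[OF I I] tensor_id2[OF aa o(1)] tensor_id2[OF aa o(2)] cellsD[OF \<phi>]
      by (simp add: left_tensor_def)
  qed
qed

text \<open>Here (f I) I is reassociated to f (I I), and \<alpha> occupies the second slot of the
  factorisation lemmas.\<close>

lemma right_endo: "fully_faithful_endo C (right_tensor C I) (\<lambda>X. id1 C X \<otimes>\<^sub>1 \<alpha>)"
proof (intro fully_faithful_endo.intro fully_faithful_endo_axioms.intro right_tensor_2functor unitD)
  note I = unitD(1) and a = unitD(2)
  note i = id1_hom[OF I] and ii = id2_id1_cells[OF I]
  have ia: "id1 C I \<in> Arr C" "id2 C (id1 C I) \<in> Cell C" and aa: "\<alpha> \<in> Arr C"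
    using homD[OF i] cellsD[OF ii] homD[OF a] by auto
  show "id1 C X \<otimes>\<^sub>1 \<alpha> \<in> hom C (on_obj (right_tensor C I) (on_obj (right_tensor C I) X)) (on_obj (right_tensor C I) X)"
    if X: "X \<in> Obj C" for X
    using tensor_hom[OF id1_hom[OF X] a] tensor_obj_assoc[OF X I I] by (simp add: right_tensor_def)
  show "on_arr (right_tensor C I) (on_arr (right_tensor C I) f) \<star>\<^sub>1 (id1 C Y \<otimes>\<^sub>1 \<alpha>) =
      (id1 C X \<otimes>\<^sub>1 \<alpha>) \<star>\<^sub>1 on_arr (right_tensor C I) f" if f: "f \<in> hom C X Y" for f X Y
    using tensor_arr_factor[OF f a] tensor_arr_assoc[OF _ ia(1) ia(1), of f] tensor_id1[OF I I] homD[OF f]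
    by (simp add: right_tensor_def)
  show "on_cell (right_tensor C I) (on_cell (right_tensor C I) \<phi>) \<star>\<^sub>2 id2 C (id1 C Y \<otimes>\<^sub>1 \<alpha>) =
      id2 C (id1 C X \<otimes>\<^sub>1 \<alpha>) \<star>\<^sub>2 on_cell (right_tensor C I) \<phi>"
    if f: "f \<in> hom C X Y" and \<phi>: "\<phi> \<in> cells C f g" for f X Y \<phi> g
  proof -
    have o: "id1 C X \<in> Arr C" "id1 C Y \<in> Arr C" using homD[OF f] id1_hom homD by blast+
    show ?thesis
      using tensor_cell_factor[OF \<phi> f unitD(4) a] tensor_cell_assoc[OF _ ia(2) ia(2), of \<phi>]
        tensor_id2[OF ia(1) ia(1)] tensor_id1[OF I I] tensor_id2[OF o(1) aa] tensor_id2[OF o(2) aa] cellsD[OF \<phi>]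
      by (simp add: right_tensor_def)
  qed
qed

text \<open>The arrow \<alpha> X is the image of \<alpha> under tensoring on the right with
  \<open>X\<close>, and strict 2-functors preserve equi-arrows. The lifting itself is along
  tensoring on the left with \<open>I\<close>.\<close>

lemma left_unit_pair_exists:
  assumes X: "X \<in> Obj C"
  shows "\<exists>l L. left_unit_pair C I \<alpha> X l L"
proof -
  have "equi_arrow C (\<alpha> \<otimes>\<^sub>1 id1 C X)"
    using strict_2functor.pres_equi_arrow[OF right_tensor_2functor[OF X] unitD(3,2)]
    by (simp add: right_tensor_def)
  from fully_faithful_endo.lift_exists[OF left_endo X this] show ?thesis
    unfolding left_unit_pair_def isomorphic_arrows_def left_tensor_def by simp blast
qed

lemma right_unit_pair_exists:
  assumes X: "X \<in> Obj C"
  shows "\<exists>r R. right_unit_pair C I \<alpha> X r R"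
proof -
  have "equi_arrow C (id1 C X \<otimes>\<^sub>1 \<alpha>)"
    using strict_2functor.pres_equi_arrow[OF left_tensor_2functor[OF X] unitD(3,2)]
    by (simp add: left_tensor_def)
  from fully_faithful_endo.lift_exists[OF right_endo X this]
  obtain r where r: "r \<in> hom C (X \<otimes>\<^sub>0 I) X" "equi_arrow C r"
      "isomorphic_arrows C (r \<otimes>\<^sub>1 id1 C I) (id1 C X \<otimes>\<^sub>1 \<alpha>)"
    unfolding right_tensor_def by auto
  \<comment> \<open>\<open>right_unit_pair\<close> orients \<open>R\<close> out of X \<alpha>, so
    the isomorphism coming from the lift is reversed.\<close>
  from isomorphic_arrows_sym[OF r(3)] r(1,2) show ?thesis
    unfolding right_unit_pair_def isomorphic_arrows_def by blast
qed

lemma left_unit_natural: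
  assumes lL: "\<forall>X\<in>Obj C. left_unit_pair C I \<alpha> X (l X) (L X)"
  shows "\<exists>!lc. lc \<in> extensional (Arr C) \<and> pseudonatural C C (left_tensor C I) id_2functor l lc \<and>
    left_modification C I lc L"
proof -
  interpret lifted_family C "left_tensor C I" "\<lambda>X. \<alpha> \<otimes>\<^sub>1 id1 C X" l L
    by (intro lifted_family.intro lifted_family_axioms.intro left_endo)
      (use lL in \<open>simp_all add: left_unit_pair_def left_tensor_def\<close>)
  show ?thesis
    using pseudonatural_lift_unique unfolding left_modification_def by (simp add: left_tensor_def)
qed

lemma right_unit_natural:
  assumes rR: "\<forall>X\<in>Obj C. right_unit_pair C I \<alpha> X (r X) (R X)"
  shows "\<exists>!rc. rc \<in> extensional (Arr C) \<and> pseudonatural C C (right_tensor C I) id_2functor r rc \<and>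
    right_modification C I rc R"
proof -
  \<comment> \<open>The 2-cells \<open>R X\<close> point the opposite way from the 2-cells \<open>L X\<close> of the lifted family,
    so the inverses of the \<open>R X\<close> take their place.\<close>
  have "\<forall>X\<in>Obj C. \<exists>S. S \<in> cells C (r X \<otimes>\<^sub>1 id1 C I) (id1 C X \<otimes>\<^sub>1 \<alpha>) \<and> R X \<bullet> S = id2 C (id1 C X \<otimes>\<^sub>1 \<alpha>) \<and>
      S \<bullet> R X = id2 C (r X \<otimes>\<^sub>1 id1 C I) \<and> invertible_cell C S"
  proof
    fix X assume "X \<in> Obj C"
    then have "invertible_cell C (R X)" "R X \<in> cells C (id1 C X \<otimes>\<^sub>1 \<alpha>) (r X \<otimes>\<^sub>1 id1 C I)"
      using rR by (auto simp: right_unit_pair_def)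
    from invertible_cellE[OF this] show "\<exists>S. S \<in> cells C (r X \<otimes>\<^sub>1 id1 C I) (id1 C X \<otimes>\<^sub>1 \<alpha>) \<and>
      R X \<bullet> S = id2 C (id1 C X \<otimes>\<^sub>1 \<alpha>) \<and> S \<bullet> R X = id2 C (r X \<otimes>\<^sub>1 id1 C I) \<and> invertible_cell C S"
      by metis
  qed
  from bchoice[OF this] obtain S where S: "\<And>X. X \<in> Obj C \<Longrightarrow>
      S X \<in> cells C (r X \<otimes>\<^sub>1 id1 C I) (id1 C X \<otimes>\<^sub>1 \<alpha>) \<and> R X \<bullet> S X = id2 C (id1 C X \<otimes>\<^sub>1 \<alpha>) \<and>
      S X \<bullet> R X = id2 C (r X \<otimes>\<^sub>1 id1 C I) \<and> invertible_cell C (S X)"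
    by blast
  interpret lifted_family C "right_tensor C I" "\<lambda>X. id1 C X \<otimes>\<^sub>1 \<alpha>" r S
    by (intro lifted_family.intro lifted_family_axioms.intro right_endo)
      (use rR S in \<open>simp_all add: right_unit_pair_def right_tensor_def\<close>)
  let ?F = "right_tensor C I" and ?A = "\<lambda>X. id1 C X \<otimes>\<^sub>1 \<alpha>"
  have R: "R X \<in> cells C (?A X) (on_arr ?F (r X))" "R X \<bullet> S X = id2 C (?A X)"
    "S X \<bullet> R X = id2 C (on_arr ?F (r X))" if "X \<in> Obj C" for X
    using that rR S by (auto simp: right_unit_pair_def right_tensor_def)
  \<comment> \<open>An instance of \<open>inverse_swap\<close>: the whiskered \<open>R\<close> are
    inverse to the whiskered \<open>S\<close>. Pseudonaturality of \<open>rc\<close> gives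
    \<open>rc f\<close> its boundary.\<close>
  have swap: "on_cell ?F (rc f) \<bullet> (S X \<star>\<^sub>2 id2 C (on_arr ?F f)) = id2 C (on_arr ?F (on_arr ?F f)) \<star>\<^sub>2 S Y \<longleftrightarrow>
      R X \<star>\<^sub>2 id2 C (on_arr ?F f) = (id2 C (on_arr ?F (on_arr ?F f)) \<star>\<^sub>2 R Y) \<bullet> on_cell ?F (rc f)"
    if pn: "pseudonatural C C ?F id_2functor r rc" and f: "f \<in> hom C X Y" for rc f X Y
  proof -
    have X: "X \<in> Obj C" and Y: "Y \<in> Obj C" using homD[OF f] by auto
    note Ff = arr[OF f]
    note FFf = arr[OF Ff]
    have Fr: "on_arr ?F (r X) \<in> hom C (on_obj ?F (on_obj ?F X)) (on_obj ?F X)"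
      "on_arr ?F (r Y) \<in> hom C (on_obj ?F (on_obj ?F Y)) (on_obj ?F Y)"
      using arr[OF l[OF X]] arr[OF l[OF Y]] by auto
    note iFf = id2_cells_hom[OF Ff] and iFFf = id2_cells_hom[OF FFf]
    have rc: "rc f \<in> cells C (on_arr ?F f \<star>\<^sub>1 r Y) (r X \<star>\<^sub>1 f)"
      using pn X Y f unfolding pseudonatural_def by (simp add: id_2functor_def)
    show ?thesis
    proof (rule inverse_swap[OF cell[OF rc] whiskered_source(1)[OF f] _ _ _ whiskered_target(1)[OF f]])
      show "R X \<star>\<^sub>2 id2 C (on_arr ?F f) \<in> cells C (?A X \<star>\<^sub>1 on_arr ?F f) (on_arr ?F (r X \<star>\<^sub>1 f))"
        using hcomp_cells_hom[OF R(1)[OF X] iFf A[OF X] Ff] boundary(4)[OF f] by simp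
      show "(S X \<star>\<^sub>2 id2 C (on_arr ?F f)) \<bullet> (R X \<star>\<^sub>2 id2 C (on_arr ?F f)) = id2 C (on_arr ?F (r X \<star>\<^sub>1 f))"
        using whisker_right_vcomp[OF Ff Fr(1) L[OF X] R(1)[OF X]] R(3)[OF X] hcomp_id2[OF Fr(1) Ff]
          boundary(4)[OF f] by simp
      show "(R X \<star>\<^sub>2 id2 C (on_arr ?F f)) \<bullet> (S X \<star>\<^sub>2 id2 C (on_arr ?F f)) = id2 C (?A X \<star>\<^sub>1 on_arr ?F f)"
        using whisker_right_vcomp[OF Ff A[OF X] R(1)[OF X] L[OF X]] R(2)[OF X] hcomp_id2[OF A[OF X] Ff]
        by simp
      show "id2 C (on_arr ?F (on_arr ?F f)) \<star>\<^sub>2 R Y \<in> cells C (?A X \<star>\<^sub>1 on_arr ?F f) (on_arr ?F (on_arr ?F f \<star>\<^sub>1 r Y))"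
        using hcomp_cells_hom[OF iFFf R(1)[OF Y] FFf A[OF Y]] boundary(3)[OF f] A_nat[OF f] by simp
      show "(id2 C (on_arr ?F (on_arr ?F f)) \<star>\<^sub>2 S Y) \<bullet> (id2 C (on_arr ?F (on_arr ?F f)) \<star>\<^sub>2 R Y) =
          id2 C (on_arr ?F (on_arr ?F f \<star>\<^sub>1 r Y))"
        using whisker_left_vcomp[OF FFf Fr(2) L[OF Y] R(1)[OF Y]] R(3)[OF Y] hcomp_id2[OF FFf Fr(2)]
          boundary(3)[OF f] by simp
      show "(id2 C (on_arr ?F (on_arr ?F f)) \<star>\<^sub>2 R Y) \<bullet> (id2 C (on_arr ?F (on_arr ?F f)) \<star>\<^sub>2 S Y) =
          id2 C (?A X \<star>\<^sub>1 on_arr ?F f)"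
        using whisker_left_vcomp[OF FFf A[OF Y] R(1)[OF Y] L[OF Y]] R(2)[OF Y] hcomp_id2[OF FFf A[OF Y]]
          A_nat[OF f] by simp
    qed
  qed
  have "right_modification C I rc R \<longleftrightarrow> (\<forall>X\<in>Obj C. \<forall>Y\<in>Obj C. \<forall>f\<in>hom C X Y.
      on_cell ?F (rc f) \<bullet> (S X \<star>\<^sub>2 id2 C (on_arr ?F f)) = id2 C (on_arr ?F (on_arr ?F f)) \<star>\<^sub>2 S Y)"
    if "pseudonatural C C ?F id_2functor r rc" for rc
    using swap[OF that] unfolding right_modification_def by (simp add: right_tensor_def)
  \<comment> \<open>The two forms of the law agree for pseudonatural \<open>rc\<close>, and
    \<open>conj_cong\<close> makes that conjunct available while the modification conjunct is
    rewritten.\<close>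
  then show ?thesis
    using pseudonatural_lift_unique by (simp cong: conj_cong)
qed

end

end

theorem lemma3p1:
  fixes C :: "('o, 'a, 'c) semi_monoidal_2cat" and I :: 'o and \<alpha> :: 'a
  assumes "semi_monoidal_2category C"
    and "unit_object C I \<alpha>"
  shows
    "(\<forall>X\<in>Obj C. (\<exists>l L. left_unit_pair C I \<alpha> X l L) \<and> (\<exists>r R. right_unit_pair C I \<alpha> X r R)) \<and>
     (\<forall>l L. (\<forall>X\<in>Obj C. left_unit_pair C I \<alpha> X (l X) (L X)) \<longrightarrow>
        (\<exists>!lc. lc \<in> extensional (Arr C) \<and>
               pseudonatural C C (left_tensor C I) id_2functor l lc \<and>
               left_modification C I lc L)) \<and>
     (\<forall>r R. (\<forall>X\<in>Obj C. right_unit_pair C I \<alpha> X (r X) (R X)) \<longrightarrow>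
        (\<exists>!rc. rc \<in> extensional (Arr C) \<and>
               pseudonatural C C (right_tensor C I) id_2functor r rc \<and>
               right_modification C I rc R))"
  using semi_monoidal_2category.left_unit_pair_exists[OF assms]
    semi_monoidal_2category.right_unit_pair_exists[OF assms]
    semi_monoidal_2category.left_unit_natural[OF assms]
    semi_monoidal_2category.right_unit_natural[OF assms]
  by simp

end
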